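(* Let $d,\alpha\in\mathbb{N}$. For a function $f$ on the unit cube $[0,1]^d$ having mixed partial derivatives up to order $\alpha-1$ in each variable which are absolutely continuous and of which the derivatives with the highest order $\alpha$ are integrable, we have the following equivalent representations for all $\boldsymbol x\in[0,1]^d$: (i) series representation in terms of Bernoulli polynomials with remainder term $$f(\boldsymbol x)=\sum_{\emptyset\ne\mathfrak u\subseteq\{1,\ldots,d\}}(-1)^{|\mathfrak u|+1}\sum_{\substack{\boldsymbol\tau_{\mathfrak u}\in\{0,\ldots,\alpha\}^{|\mathfrak u|}\\ \tau_j=0\text{ for }j\notin\mathfrak u}}\left[\prod_{j\in\mathfrak u}\frac{B_{\tau_j}(x_j)}{\tau_j!}\right]\int_{[0,1]^{|\mathfrak u|}}f^{(\boldsymbol\tau)}(\boldsymbol x_{-\mathfrak u},\boldsymbol y_{\mathfrak u})\,\mathrm{d}\boldsymbol y_{\mathfrak u}+(-1)^d\int_{[0,1]^d}\left[\prod_{j=1}^d\frac{\widetilde B_\alpha(x_j-y_j)}{\alpha!}\right]f^{(\alpha,\ldots,\alpha)}(\boldsymbol y)\,\mathrm{d}\boldsymbol y;$$ (ii) series representation in terms of Bernoulli polynomials with mixed remainder terms $$f(\boldsymbol x)=\sum_{\mathfrak u\subseteq\{1,\ldots,d\}}(-1)^{d-|\mathfrak u|}\sum_{\substack{\boldsymbol\tau_{\mathfrak u}\in\{0,\ldots,\alpha\}^{|\mathfrak u|}\\ \tau_j=\alpha\text{ for }j\notin\mathfrak u}}\left[\prod_{j\in\mathfrak u}\frac{B_{\tau_j}(x_j)}{\tau_j!}\right]\int_{[0,1]^d}\left[\prod_{j\notin\mathfrak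 u}\frac{\widetilde B_\alpha(x_j-y_j)}{\alpha!}\right]f^{(\boldsymbol\tau)}(\boldsymbol y)\,\mathrm{d}\boldsymbol y.$$
   Context: Notation: $f^{(\boldsymbol\tau)}=\partial^{\tau_1+\cdots+\tau_d}f/\partial x_1^{\tau_1}\cdots\partial x_d^{\tau_d}$. For $\mathfrak u\subseteq\{1,\ldots,d\}$, $-\mathfrak u$ is its complement, $\boldsymbol x_{\mathfrak u}=(x_j)_{j\in\mathfrak u}$, and $(\boldsymbol x_{-\mathfrak u},\boldsymbol y_{\mathfrak u})$ is the vector with components $y_j$ for $j\in\mathfrak u$ and $x_j$ for $j\notin\mathfrak u$. In each sum, $\boldsymbol\tau_{\mathfrak u}$ together with the prescribed values for $j\notin\mathfrak u$ forms the multi-index $\boldsymbol\tau$. $B_\tau$ is the Bernoulli polynomial of degree $\tau$ ($B_0=1$, $B_1(x)=x-1/2$, $\ldots$) and $\widetilde B_\tau$ is the $1$-periodic function equal to $B_\tau$ on $[0,1]$ for $\tau\ge2$ and on $(0,1)$ for $\tau=1$. Absolute continuity is used in each variable on the interval, so that the fundamental theorem of calculus holds in that variable; derivatives involving order $\alpha$ exist almost everywhere.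
   Formalization: Absolute continuity in each variable is also required of mixed derivatives with some entries of order α (for a.e. value of those coordinates), with order-independent mixed derivatives; asked only of derivatives up to order α−1 per variable, the claim fails (Cantor-function example, d=2, α=1). *)

theory Defs
  imports "HOL-Analysis.Analysis"
begin

(* Points of [0,1]^u, for a finite set u of coordinates, are the elements of
   u \<rightarrow>\<^sub>E {0..1}; the cube [0,1]^d is the case u = {1..d}.  The vector
   (x_{-u}, y_u) is written override_on x y u. *)

fun bernoulli :: "nat \<Rightarrow> real" where
  "bernoulli 0 = 1"
| "bernoulli (Suc n) = - (\<Sum>k\<le>n. real (n + 2 choose k) * bernoulli k) / real (n + 2)"

definition bernpoly :: "nat \<Rightarrow> real \<Rightarrow> real" where
  "bernpoly n x = (\<Sum>k\<le>n. real (n choose k) * bernoulli k * x ^ (n - k))"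

(* For n = 1 the value at the integers is -1/2; it enters only under integrals. *)
definition pbernpoly :: "nat \<Rightarrow> real \<Rightarrow> real" where
  "pbernpoly n x = bernpoly n (frac x)"

(* This is Lebesgue measure on [0,1]^u. *)
definition cube_lebesgue :: "nat set \<Rightarrow> (nat \<Rightarrow> real) measure" where
  "cube_lebesgue u = completion (PiM u (\<lambda>_. restrict_space lborel {0..1}))"

(* One-sided at x j = 0 and x j = 1; an unspecified constant where the derivative
   does not exist. *)
definition partial_deriv :: "nat \<Rightarrow> ((nat \<Rightarrow> real) \<Rightarrow> real) \<Rightarrow> (nat \<Rightarrow> real) \<Rightarrow> real" where
  "partial_deriv j g x = vector_derivative (\<lambda>t. g (x(j := t))) (at (x j) within {0..1})"

(* The derivative with respect to the last coordinate d is taken first. *)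
definition mixed_deriv ::
    "nat \<Rightarrow> (nat \<Rightarrow> nat) \<Rightarrow> ((nat \<Rightarrow> real) \<Rightarrow> real) \<Rightarrow> (nat \<Rightarrow> real) \<Rightarrow> real" where
  "mixed_deriv d \<tau> f = foldr (\<lambda>j. partial_deriv j ^^ \<tau> j) [1..<Suc d] f"

definition abs_continuous_on :: "real set \<Rightarrow> (real \<Rightarrow> real) \<Rightarrow> bool" where
  "abs_continuous_on S g \<longleftrightarrow>
     (\<forall>\<epsilon>>0. \<exists>\<delta>>0. \<forall>D. D division_of \<Union>D \<and> \<Union>D \<subseteq> S \<and> (\<Sum>K\<in>D. Sup K - Inf K) < \<delta>
        \<longrightarrow> (\<Sum>K\<in>D. \<bar>g (Sup K) - g (Inf K)\<bar>) < \<epsilon>)"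

(* A derivative of order \<alpha> in some coordinates need only be defined for almost all
   values of these coordinates.  So regularity of f^(\<tau>) in the coordinate i is required
   for every value of the coordinates outside u and almost every value of those in u,
   where u is any set containing all j with \<tau> j = \<alpha>; for \<tau> without entries \<alpha> one may
   take u = {}, that is, all points of the cube.  The derivative of f^(\<tau>) in the coordinate
   i is f^(\<tau> + e_i), so that mixed derivatives do not depend on the order of
   differentiation; it exists everywhere below order \<alpha> and almost everywhere at order \<alpha>.
   The integrability condition concerns the derivatives having order \<alpha> in at least one
   coordinate. *)
definition abs_continuous_mixed_derivs :: "nat \<Rightarrow> nat \<Rightarrow> ((nat \<Rightarrow> real) \<Rightarrow> real) \<Rightarrow> bool" where
  "abs_continuous_mixed_derivs d \<alpha> f \<longleftrightarrow>
     (\<forall>\<tau>\<in>{1..d} \<rightarrow>\<^sub>E {0..\<alpha>}. \<forall>i\<in>{1..d}. \<forall>u. \<forall>x\<in>{1..d} \<rightarrow>\<^sub>E {0..1}.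
        \<tau> i < \<alpha> \<and> {j\<in>{1..d}. \<tau> j = \<alpha>} \<subseteq> u \<and> u \<subseteq> {1..d} - {i} \<longrightarrow>
        (AE y in cube_lebesgue u.
           let g = (\<lambda>t. mixed_deriv d \<tau> f ((override_on x y u)(i := t)));
               g' = (\<lambda>t. mixed_deriv d (\<tau>(i := Suc (\<tau> i))) f ((override_on x y u)(i := t)))
           in abs_continuous_on {0..1} g \<and>
              (if Suc (\<tau> i) < \<alpha>
               then \<forall>t\<in>{0..1}. (g has_real_derivative g' t) (at t within {0..1})
               else AE t in lborel. t \<in> {0..1} \<longrightarrow>
                      (g has_real_derivative g' t) (at t within {0..1})))) \<and>
     (\<forall>\<tau>\<in>{1..d} \<rightarrow>\<^sub>E {0..\<alpha>}. (\<exists>j\<in>{1..d}. \<tau> j = \<alpha>) \<longrightarrow>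
        integrable (cube_lebesgue {1..d}) (mixed_deriv d \<tau> f))"

end

theory Submission
  imports Defs "HOL-Probability.Infinite_Product_Measure"
begin

text \<open>
  Write \<open>b\<^sub>k = B\<^sub>k / k!\<close>.  In one dimension, integrating by parts against the kernel
  \<open>t \<mapsto> b\<^sub>n(x - t)\<close>, continued periodically, gives
  \<open>g(x) = (\<Sum>k\<le>n. b\<^sub>k(x) \<integral> g\<^sup>(\<^sup>k\<^sup>)) - \<integral> b\<^sub>n(x - t) g\<^sup>(\<^sup>n\<^sup>)(t) dt\<close>: the function \<open>b\<^sub>1\<close> jumps by one at the
  integers and produces the term \<open>g(x)\<close>, the other periodic kernels are continuous
  (\<open>bernoulli_expansion\<close>).  This rests on the fundamental theorem of calculus for absolutely
  continuous functions (\<open>fundamental_theorem_of_calculus_abs_continuous\<close>).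

  In several dimensions, for disjoint sets \<open>u\<close>, \<open>w\<close> of coordinates let \<open>T(u, w)\<close> be the expression in
  which the coordinates in \<open>u\<close> have been treated by the Bernoulli sum, those in \<open>w\<close> by the remainder
  kernel, and the others not at all (\<open>mixed_sum\<close>).  Then \<open>T({}, {}) = f(x)\<close>, and the one-dimensional
  formula in a further coordinate \<open>i\<close>, together with Fubini's theorem, says
  \<open>T(u, w) = T(u \<union> {i}, w) - T(u, w \<union> {i})\<close> (\<open>mixed_sum_split\<close>).  Both representations follow
  from this recursion: splitting all coordinates gives
  \<open>T({}, {}) = (\<Sum>u. (-1)\<^bsup>d - |u|\<^esup> T(u, -u))\<close>, which is the second one, and
  \<open>(\<Sum>u. (-1)\<^bsup>|u|\<^esup> T(u, {})) = (-1)\<^bsup>d\<^esup> T({}, {1..d})\<close>, which is the first one because the summand for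
  \<open>u = {}\<close> is \<open>f(x)\<close>.

  Fubini's theorem requires the mixed derivatives \<open>f\<^sup>(\<^sup>\<sigma>\<^sup>)\<close> to be integrable over the cube and its slices
  with some coordinates fixed, provided that no coordinate with an entry \<open>\<alpha>\<close> in \<open>\<sigma>\<close> is fixed; the
  hypothesis gives this only for the full cube and for those \<open>\<sigma>\<close> having an entry \<open>\<alpha>\<close>.  For such \<open>\<sigma>\<close>,
  coordinates are fixed one at a time: the one-dimensional formula with \<open>n = 1\<close> expresses a value
  at a fixed point by integrals over the segment through it (\<open>integrable_mixed_deriv_top\<close>).  For
  the other \<open>\<sigma>\<close>, one integrates the derivative of \<open>f\<^sup>(\<^sup>\<sigma>\<^sup>)\<close> in one coordinate from the face where
  this coordinate vanishes; the order of that derivative is larger and the face has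
  smaller dimension, so induction applies (\<open>integrable_mixed_deriv\<close>).
\<close>

section \<open>Absolutely continuous functions\<close>

lemma division_of_real_endpoints:
  fixes K :: "real set"
  assumes "D division_of S" "K \<in> D"
  shows "Inf K \<le> Sup K" "Inf K \<in> S" "Sup K \<in> S" "measure lebesgue K = Sup K - Inf K"
proof -
  obtain u v where K: "K = {u..v}" and "K \<noteq> {}" "K \<subseteq> S"
    using assms by (metis division_ofD(2,3,4) box_real(2))
  then show "Inf K \<le> Sup K" "Inf K \<in> S" "Sup K \<in> S" "measure lebesgue K = Sup K - Inf K"
    by auto
qed

lemma abs_continuous_onE:
  assumes "abs_continuous_on S g" "\<epsilon> > 0"
  obtains \<delta> where "\<delta> > 0"
    "\<And>D. \<lbrakk>D division_of \<Union>D; \<Union>D \<subseteq> S; (\<Sum>K\<in>D. Sup K - Inf K) < \<delta>\<rbrakk>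
       \<Longrightarrow> (\<Sum>K\<in>D. \<bar>g (Sup K) - g (Inf K)\<bar>) < \<epsilon>"
proof -
  obtain \<delta> where \<delta>: "\<delta> > 0" "\<forall>D. D division_of \<Union>D \<and> \<Union>D \<subseteq> S \<and> (\<Sum>K\<in>D. Sup K - Inf K) < \<delta>
      \<longrightarrow> (\<Sum>K\<in>D. \<bar>g (Sup K) - g (Inf K)\<bar>) < \<epsilon>"
    using assms unfolding abs_continuous_on_def by blast
  show thesis
    by (rule that[OF \<delta>(1)]) (use \<delta>(2) in blast)
qed

lemma abs_continuous_on_imp_continuous_on:
  fixes g :: "real \<Rightarrow> real"
  assumes "abs_continuous_on {a..b} g"
  shows "continuous_on {a..b} g"
  unfolding continuous_on_iff
proof (intro ballI allI impI)
  fix x \<epsilon> :: real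
  assume x: "x \<in> {a..b}" and "\<epsilon> > 0"
  obtain \<delta> where "\<delta> > 0" and \<delta>:
    "\<And>D. \<lbrakk>D division_of \<Union>D; \<Union>D \<subseteq> {a..b}; (\<Sum>K\<in>D. Sup K - Inf K) < \<delta>\<rbrakk>
       \<Longrightarrow> (\<Sum>K\<in>D. \<bar>g (Sup K) - g (Inf K)\<bar>) < \<epsilon>"
    by (rule abs_continuous_onE[OF assms \<open>\<epsilon> > 0\<close>]) (rule that, assumption, blast)
  show "\<exists>d>0. \<forall>x'\<in>{a..b}. dist x' x < d \<longrightarrow> dist (g x') (g x) < \<epsilon>"
  proof (intro exI[of _ \<delta>] conjI ballI impI)
    fix y assume y: "y \<in> {a..b}" "dist y x < \<delta>"
    have "{{min x y..max x y}} division_of \<Union>{{min x y..max x y}}"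
      using division_of_self[of "min x y" "max x y"] by auto
    from \<delta>[OF this] x y show "dist (g y) (g x) < \<epsilon>"
      by (cases "x \<le> y") (auto simp: dist_real_def min_def max_def abs_minus_commute)
  qed fact
qed

lemma abs_continuous_on_mult:
  fixes p q :: "real \<Rightarrow> real"
  assumes p: "abs_continuous_on {a..b} p" and q: "abs_continuous_on {a..b} q"
  shows "abs_continuous_on {a..b} (\<lambda>t. p t * q t)"
proof -
  have bdd: "\<exists>M>0. \<forall>t\<in>{a..b}. \<bar>g t\<bar> \<le> M" if "abs_continuous_on {a..b} g" for g :: "real \<Rightarrow> real"
  proof -
    have "bounded (g ` {a..b})"
      using that by (intro compact_imp_bounded compact_continuous_image
          abs_continuous_on_imp_continuous_on) auto
    then show ?thesis
      by (auto simp: bounded_pos)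
  qed
  obtain P where P: "P > 0" "\<And>t. t \<in> {a..b} \<Longrightarrow> \<bar>p t\<bar> \<le> P"
    using bdd[OF p] by blast
  obtain Q where Q: "Q > 0" "\<And>t. t \<in> {a..b} \<Longrightarrow> \<bar>q t\<bar> \<le> Q"
    using bdd[OF q] by blast
  show ?thesis
    unfolding abs_continuous_on_def
  proof (intro allI impI)
    fix \<epsilon> :: real assume "\<epsilon> > 0"
    then have pos: "\<epsilon> / (2 * P) > 0" "\<epsilon> / (2 * Q) > 0"
      using P Q by auto
    obtain d where d: "d > 0"
      "\<And>D. \<lbrakk>D division_of \<Union>D; \<Union>D \<subseteq> {a..b}; (\<Sum>K\<in>D. Sup K - Inf K) < d\<rbrakk>
       \<Longrightarrow> (\<Sum>K\<in>D. \<bar>p (Sup K) - p (Inf K)\<bar>) < \<epsilon> / (2 * Q)"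
      by (rule abs_continuous_onE[OF p pos(2)]) (rule that, assumption, blast)
    obtain d' where d': "d' > 0"
      "\<And>D. \<lbrakk>D division_of \<Union>D; \<Union>D \<subseteq> {a..b}; (\<Sum>K\<in>D. Sup K - Inf K) < d'\<rbrakk>
       \<Longrightarrow> (\<Sum>K\<in>D. \<bar>q (Sup K) - q (Inf K)\<bar>) < \<epsilon> / (2 * P)"
      by (rule abs_continuous_onE[OF q pos(1)]) (rule that, assumption, blast)
    show "\<exists>\<delta>>0. \<forall>D. D division_of \<Union>D \<and> \<Union>D \<subseteq> {a..b} \<and> (\<Sum>K\<in>D. Sup K - Inf K) < \<delta> \<longrightarrow>
             (\<Sum>K\<in>D. \<bar>p (Sup K) * q (Sup K) - p (Inf K) * q (Inf K)\<bar>) < \<epsilon>"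
    proof (intro exI[of _ "min d d'"] conjI allI impI)
      fix D :: "real set set"
      assume "D division_of \<Union>D \<and> \<Union>D \<subseteq> {a..b} \<and> (\<Sum>K\<in>D. Sup K - Inf K) < min d d'"
      then have D: "D division_of \<Union>D" "\<Union>D \<subseteq> {a..b}" "(\<Sum>K\<in>D. Sup K - Inf K) < d"
        "(\<Sum>K\<in>D. Sup K - Inf K) < d'" by auto
      have "(\<Sum>K\<in>D. \<bar>p (Sup K) * q (Sup K) - p (Inf K) * q (Inf K)\<bar>)
          \<le> (\<Sum>K\<in>D. P * \<bar>q (Sup K) - q (Inf K)\<bar> + Q * \<bar>p (Sup K) - p (Inf K)\<bar>)"
      proof (rule sum_mono)
        fix K assume "K \<in> D"
        then have K: "Inf K \<in> {a..b}" "Sup K \<in> {a..b}"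
          using D division_of_real_endpoints[of D "\<Union>D" K] by auto
        have "p (Sup K) * q (Sup K) - p (Inf K) * q (Inf K)
            = p (Sup K) * (q (Sup K) - q (Inf K)) + q (Inf K) * (p (Sup K) - p (Inf K))"
          by (simp add: algebra_simps)
        also have "\<bar>\<dots>\<bar> \<le> \<bar>p (Sup K)\<bar> * \<bar>q (Sup K) - q (Inf K)\<bar> + \<bar>q (Inf K)\<bar> * \<bar>p (Sup K) - p (Inf K)\<bar>"
          by (metis abs_mult abs_triangle_ineq)
        also have "\<dots> \<le> P * \<bar>q (Sup K) - q (Inf K)\<bar> + Q * \<bar>p (Sup K) - p (Inf K)\<bar>"
          by (intro add_mono mult_right_mono P Q K) auto
        finally show "\<bar>p (Sup K) * q (Sup K) - p (Inf K) * q (Inf K)\<bar>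
          \<le> P * \<bar>q (Sup K) - q (Inf K)\<bar> + Q * \<bar>p (Sup K) - p (Inf K)\<bar>" .
      qed
      also have "\<dots> = P * (\<Sum>K\<in>D. \<bar>q (Sup K) - q (Inf K)\<bar>) + Q * (\<Sum>K\<in>D. \<bar>p (Sup K) - p (Inf K)\<bar>)"
        by (simp add: sum.distrib sum_distrib_left)
      also have "\<dots> < P * (\<epsilon> / (2 * P)) + Q * (\<epsilon> / (2 * Q))"
        by (intro add_strict_mono mult_strict_left_mono P Q d d' D)
      also have "\<dots> = \<epsilon>"
        using P Q by simp
      finally show "(\<Sum>K\<in>D. \<bar>p (Sup K) * q (Sup K) - p (Inf K) * q (Inf K)\<bar>) < \<epsilon>" .
    qed (use d d' in auto)
  qed
qed

lemma lipschitz_on_imp_abs_continuous_on: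
  fixes g :: "real \<Rightarrow> real"
  assumes "C-lipschitz_on S g"
  shows "abs_continuous_on S g"
  unfolding abs_continuous_on_def
proof (intro allI impI)
  fix \<epsilon> :: real assume "\<epsilon> > 0"
  have C: "C \<ge> 0"
    using assms lipschitz_on_nonneg by blast
  show "\<exists>\<delta>>0. \<forall>D. D division_of \<Union>D \<and> \<Union>D \<subseteq> S \<and> (\<Sum>K\<in>D. Sup K - Inf K) < \<delta> \<longrightarrow>
           (\<Sum>K\<in>D. \<bar>g (Sup K) - g (Inf K)\<bar>) < \<epsilon>"
  proof (intro exI[of _ "\<epsilon> / (C + 1)"] conjI allI impI)
    fix D :: "real set set"
    assume "D division_of \<Union>D \<and> \<Union>D \<subseteq> S \<and> (\<Sum>K\<in>D. Sup K - Inf K) < \<epsilon> / (C + 1)"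
    then have D: "D division_of \<Union>D" "\<Union>D \<subseteq> S" "(\<Sum>K\<in>D. Sup K - Inf K) < \<epsilon> / (C + 1)"
      by auto
    have "(\<Sum>K\<in>D. \<bar>g (Sup K) - g (Inf K)\<bar>) \<le> (\<Sum>K\<in>D. (C + 1) * (Sup K - Inf K))"
    proof (rule sum_mono)
      fix K assume "K \<in> D"
      then have K: "Inf K \<in> S" "Sup K \<in> S" "Inf K \<le> Sup K"
        using D division_of_real_endpoints[of D "\<Union>D" K] by auto
      have "\<bar>g (Sup K) - g (Inf K)\<bar> \<le> C * (Sup K - Inf K)"
        using lipschitz_onD[OF assms K(2,1)] K(3) by (simp add: dist_real_def)
      also have "\<dots> \<le> (C + 1) * (Sup K - Inf K)"
        using K by (intro mult_right_mono) auto
      finally show "\<bar>g (Sup K) - g (Inf K)\<bar> \<le> (C + 1) * (Sup K - Inf K)" .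
    qed
    also have "\<dots> = (C + 1) * (\<Sum>K\<in>D. Sup K - Inf K)"
      by (simp add: sum_distrib_left)
    also have "\<dots> < \<epsilon>"
      using D(3) C by (simp add: field_simps)
    finally show "(\<Sum>K\<in>D. \<bar>g (Sup K) - g (Inf K)\<bar>) < \<epsilon>" .
  qed (use \<open>\<epsilon> > 0\<close> C in auto)
qed

lemma abs_continuous_on_subset:
  "abs_continuous_on T g \<Longrightarrow> S \<subseteq> T \<Longrightarrow> abs_continuous_on S g"
  unfolding abs_continuous_on_def by (meson order_trans)

lemma negligible_outer_open:
  fixes N :: "real set"
  assumes "negligible N" "\<delta> > 0"
  obtains U where "open U" "N \<subseteq> U" "U \<in> lmeasurable" "measure lebesgue U < \<delta>"
proof -
  obtain U where U: "open U" "N \<subseteq> U" "U - N \<in> lmeasurable" "emeasure lebesgue (U - N) < ennreal \<delta>"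
    using sets_lebesgue_outer_open[OF negligible_imp_sets[OF assms(1)] assms(2)] by metis
  have N: "N \<in> null_sets lebesgue"
    using assms(1) by (simp add: negligible_iff_null_sets)
  have Us: "U \<in> sets lebesgue"
    using U(1) by auto
  have eq: "emeasure lebesgue (U - N) = emeasure lebesgue U"
    using N Us by (rule emeasure_Diff_null_set)
  have "U \<in> lmeasurable"
    using U(4) Us eq by (intro fmeasurableI) (auto simp: less_top[symmetric])
  moreover have "measure lebesgue U < \<delta>"
    using U(4) eq calculation assms(2) by (simp add: emeasure_eq_measure2 ennreal_less_iff)
  ultimately show ?thesis
    using U that by blast
qed

text \<open>A gauge is chosen as usual at the points where \<open>f\<close> is differentiable, and inside an open set of
  small measure at the points of the exceptional null set.  Absolute continuity bounds
  the total increment of \<open>f\<close> over the intervals tagged in the null set.\<close>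
lemma fundamental_theorem_of_calculus_abs_continuous:
  fixes f f' :: "real \<Rightarrow> real"
  assumes "a \<le> b" and ac: "abs_continuous_on {a..b} f" and N: "negligible N"
    and der: "\<And>x. x \<in> {a..b} - N \<Longrightarrow> (f has_real_derivative f' x) (at x within {a..b})"
  shows "(f' has_integral (f b - f a)) {a..b}"
proof (rule has_integral_spike[OF N])
  define h where "h x = (if x \<in> N then 0 else f' x)" for x
  show "f' x = h x" if "x \<in> {a..b} - N" for x
    using that by (simp add: h_def)
  show "(h has_integral (f b - f a)) {a..b}"
    unfolding has_integral_real
  proof (intro allI impI)
    fix \<epsilon> :: real assume "\<epsilon> > 0"
    define e where "e = \<epsilon> / (2 * (b - a + 1))"
    have "e > 0"
      using \<open>\<epsilon> > 0\<close> \<open>a \<le> b\<close> by (simp add: e_def)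
    obtain \<delta> where "\<delta> > 0" and \<delta>:
      "\<And>D. \<lbrakk>D division_of \<Union>D; \<Union>D \<subseteq> {a..b}; (\<Sum>K\<in>D. Sup K - Inf K) < \<delta>\<rbrakk>
       \<Longrightarrow> (\<Sum>K\<in>D. \<bar>f (Sup K) - f (Inf K)\<bar>) < \<epsilon> / 2"
      by (rule abs_continuous_onE[OF ac half_gt_zero[OF \<open>\<epsilon> > 0\<close>]]) (rule that, assumption, blast)
    obtain U where U: "open U" "N \<subseteq> U" "U \<in> lmeasurable" "measure lebesgue U < \<delta>"
      using negligible_outer_open[OF N \<open>\<delta> > 0\<close>] by metis
    have "\<exists>d>0. x \<in> {a..b} - N \<longrightarrow>
         (\<forall>y\<in>{a..b}. \<bar>y - x\<bar> < d \<longrightarrow> \<bar>f y - f x - (y - x) * f' x\<bar> \<le> e * \<bar>y - x\<bar>)" for x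
    proof (cases "x \<in> {a..b} - N")
      case True
      then show ?thesis
        using der[OF True, unfolded has_field_derivative_def has_derivative_within_alt] \<open>e > 0\<close>
        by (simp add: mult.commute)
    next
      case False
      then show ?thesis
        by (intro exI[of _ 1]) auto
    qed
    then obtain d where d: "\<And>x. 0 < d x"
       "\<And>x y. \<lbrakk>x \<in> {a..b} - N; y \<in> {a..b}; \<bar>y - x\<bar> < d x\<rbrakk>
          \<Longrightarrow> \<bar>f y - f x - (y - x) * f' x\<bar> \<le> e * \<bar>y - x\<bar>"
      by metis
    define \<gamma> where "\<gamma> x = (if x \<in> N then U else ball x (d x))" for x
    show "\<exists>\<gamma>. gauge \<gamma> \<and> (\<forall>p. p tagged_division_of {a..b} \<and> \<gamma> fine p \<longrightarrow>
        norm ((\<Sum>(x, k)\<in>p. measure lborel k *\<^sub>R h x) - (f b - f a)) < \<epsilon>)"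
    proof (intro exI[of _ \<gamma>] conjI allI impI)
      show "gauge \<gamma>"
        using U d by (auto simp: gauge_def \<gamma>_def)
      fix p assume "p tagged_division_of {a..b} \<and> \<gamma> fine p"
      then have p: "p tagged_division_of {a..b}" and fine: "\<gamma> fine p" by auto
      note pD = tagged_division_ofD[OF p]
      define p1 where "p1 = {(x, K) \<in> p. x \<in> N}"
      define p2 where "p2 = {(x, K) \<in> p. x \<notin> N}"
      have fin: "finite p1" "finite p2" and split: "p = p1 \<union> p2" "p1 \<inter> p2 = {}"
        using pD(1) by (auto simp: p1_def p2_def intro: finite_subset[of _ p])
      have interval: "\<exists>u v. K = {u..v} \<and> u \<le> x \<and> x \<le> v \<and> {u..v} \<subseteq> {a..b}" if "(x, K) \<in> p" for x K
      proof -
        obtain u v where K: "K = cbox u v"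
          using pD(4)[of x K] \<open>(x, K) \<in> p\<close> by blast
        then show ?thesis
          using pD(2,3)[of x K] \<open>(x, K) \<in> p\<close> by (intro exI[of _ u] exI[of _ v]) auto
      qed
      have small2: "(\<Sum>(x, K)\<in>p2. \<bar>measure lborel K * h x - (f (Sup K) - f (Inf K))\<bar>)
          \<le> (\<Sum>(x, K)\<in>p2. e * (Sup K - Inf K))"
      proof (rule sum_mono, clarify)
        fix x K assume "(x, K) \<in> p2"
        then have xK: "(x, K) \<in> p" "x \<notin> N" by (auto simp: p2_def)
        then obtain u v where K: "K = {u..v}" "u \<le> x" "x \<le> v" "{u..v} \<subseteq> {a..b}"
          using interval by blast
        have "K \<subseteq> ball x (d x)"
          using fineD[OF fine xK(1)] xK(2) by (simp add: \<gamma>_def)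
        moreover have "u \<in> K" "v \<in> K"
          using K by auto
        ultimately have near: "\<bar>u - x\<bar> < d x" "\<bar>v - x\<bar> < d x"
          by (auto simp: subset_iff dist_real_def abs_minus_commute)
        have mem: "u \<in> {a..b}" "v \<in> {a..b}" "x \<in> {a..b} - N"
          using K xK by auto
        have "measure lborel K * h x - (f v - f u)
            = (f u - f x - (u - x) * f' x) - (f v - f x - (v - x) * f' x)"
          using K xK by (simp add: h_def algebra_simps)
        also have "\<bar>\<dots>\<bar> \<le> \<bar>f u - f x - (u - x) * f' x\<bar> + \<bar>f v - f x - (v - x) * f' x\<bar>"
          by (rule abs_triangle_ineq4)
        also have "\<dots> \<le> e * \<bar>u - x\<bar> + e * \<bar>v - x\<bar>"
          by (intro add_mono d(2) mem near)
        also have "\<dots> = e * (v - u)"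
          using K by (simp add: algebra_simps)
        finally show "\<bar>measure lborel K * h x - (f (Sup K) - f (Inf K))\<bar> \<le> e * (Sup K - Inf K)"
          using K by simp
      qed
      also have "\<dots> \<le> (\<Sum>(x, K)\<in>p. e * (Sup K - Inf K))"
        using interval \<open>e > 0\<close> by (intro sum_mono2) (auto simp: pD(1) p2_def, fastforce)
      also have "\<dots> = e * (\<Sum>(x, K)\<in>p. Sup K - Inf K)"
        by (simp add: sum_distrib_left case_prod_unfold)
      also have "(\<Sum>(x, K)\<in>p. Sup K - Inf K) = b - a"
        using additive_tagged_division_1[OF \<open>a \<le> b\<close> p, of "\<lambda>x. x"] by simp
      also have "e * (b - a) < \<epsilon> / 2"
        using \<open>a \<le> b\<close> \<open>\<epsilon> > 0\<close> by (simp add: e_def field_simps)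
      finally have bound2: "(\<Sum>(x, K)\<in>p2. \<bar>measure lborel K * h x - (f (Sup K) - f (Inf K))\<bar>) < \<epsilon> / 2" .

      define D where "D = snd ` p1"
      have p1: "p1 tagged_division_of \<Union>D"
        unfolding D_def
        by (rule tagged_partial_division_of_Union_self, rule tagged_partial_division_subset[of p "{a..b}"])
          (use p in \<open>auto simp: p1_def tagged_division_of_def\<close>)
      then have D: "D division_of \<Union>D"
        using division_of_tagged_division D_def by blast
      have DU: "\<Union>D \<subseteq> U"
        using fineD[OF fine] by (fastforce simp: D_def p1_def \<gamma>_def)
      have "(\<Sum>K\<in>D. Sup K - Inf K) = (\<Sum>K\<in>D. measure lebesgue K)"
        by (intro sum.cong refl) (use division_of_real_endpoints[OF D] in auto)
      also have "\<dots> = measure lebesgue (\<Union>D)"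
        by (rule content_division[OF D])
      also have "\<dots> \<le> measure lebesgue U"
        using U DU D by (intro measure_mono_fmeasurable) (auto intro: lmeasurable_division fmeasurableD)
      finally have "(\<Sum>K\<in>D. Sup K - Inf K) < \<delta>"
        using U by simp
      moreover have "\<Union>D \<subseteq> {a..b}"
        using pD(3) by (fastforce simp: D_def p1_def)
      ultimately have "(\<Sum>K\<in>D. \<bar>f (Sup K) - f (Inf K)\<bar>) < \<epsilon> / 2"
        by (intro \<delta> D)
      also have "(\<Sum>K\<in>D. \<bar>f (Sup K) - f (Inf K)\<bar>) = (\<Sum>(x, K)\<in>p1. \<bar>f (Sup K) - f (Inf K)\<bar>)"
      proof -

        \<comment> \<open>Distinct tags may share an interval, but only a degenerate one, over which \<open>f\<close> has increment zero.
          Setting \<open>g\<close> to zero there by definition meets the side condition of the reindexing rule.\<close>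
        define g where "g K = (if interior K = {} then 0 else \<bar>f (Sup K) - f (Inf K)\<bar>)" for K
        have g: "g K = \<bar>f (Sup K) - f (Inf K)\<bar>" if K: "K \<in> D" for K
        proof -
          obtain x where "(x, K) \<in> p"
            using K by (auto simp: D_def p1_def)
          then obtain u v where "K = {u..v}" "u \<le> x" "x \<le> v"
            using interval by blast
          then show ?thesis
            by (cases "u = v") (simp_all add: g_def)
        qed
        have "(\<Sum>K\<in>D. \<bar>f (Sup K) - f (Inf K)\<bar>) = sum g D"
          by (intro sum.cong) (auto simp: g)
        also have "\<dots> = (\<Sum>(x, K)\<in>p1. g K)"
          unfolding D_def by (rule sum.over_tagged_division_lemma[OF p1, symmetric]) (simp add: g_def)
        also have "\<dots> = (\<Sum>(x, K)\<in>p1. \<bar>f (Sup K) - f (Inf K)\<bar>)"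
          by (intro sum.cong refl) (use g D_def in force)
        finally show ?thesis .
      qed
      finally have "(\<Sum>(x, K)\<in>p1. \<bar>f (Sup K) - f (Inf K)\<bar>) < \<epsilon> / 2" .
      also have "(\<Sum>(x, K)\<in>p1. \<bar>f (Sup K) - f (Inf K)\<bar>)
          = (\<Sum>(x, K)\<in>p1. \<bar>measure lborel K * h x - (f (Sup K) - f (Inf K))\<bar>)"
        by (intro sum.cong refl) (auto simp: p1_def h_def)
      finally have bound1: "(\<Sum>(x, K)\<in>p1. \<bar>measure lborel K * h x - (f (Sup K) - f (Inf K))\<bar>) < \<epsilon> / 2" .
      have "(\<Sum>(x, K)\<in>p. measure lborel K *\<^sub>R h x) - (f b - f a)
          = (\<Sum>(x, K)\<in>p. measure lborel K * h x - (f (Sup K) - f (Inf K)))"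
        using additive_tagged_division_1[OF \<open>a \<le> b\<close> p, of f]
        by (simp add: sum_subtractf case_prod_unfold)
      also have "norm \<dots> \<le> (\<Sum>(x, K)\<in>p. \<bar>measure lborel K * h x - (f (Sup K) - f (Inf K))\<bar>)"
        by (rule order_trans[OF norm_sum]) (simp add: case_prod_unfold)
      also have "\<dots> = (\<Sum>(x, K)\<in>p1. \<bar>measure lborel K * h x - (f (Sup K) - f (Inf K))\<bar>)
          + (\<Sum>(x, K)\<in>p2. \<bar>measure lborel K * h x - (f (Sup K) - f (Inf K))\<bar>)"
        unfolding split(1) by (rule sum.union_disjoint[OF fin split(2)])
      also have "\<dots> < \<epsilon>"
        using bound1 bound2 by simp
      finally show "norm ((\<Sum>(x, K)\<in>p. measure lborel K *\<^sub>R h x) - (f b - f a)) < \<epsilon>" .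
    qed
  qed
qed

section \<open>Bernoulli polynomials and the expansion in one variable\<close>

lemma has_field_derivative_bernpoly:
  "(bernpoly (Suc n) has_real_derivative real (Suc n) * bernpoly n x) (at x within S)"
proof -
  have "((\<lambda>x. \<Sum>k\<le>Suc n. real (Suc n choose k) * bernoulli k * x ^ (Suc n - k)) has_real_derivative
      (\<Sum>k\<le>Suc n. real (Suc n choose k) * bernoulli k * (real (Suc n - k) * x ^ (Suc n - k - 1)))) (at x within S)"
    by (auto intro!: derivative_eq_intros simp: mult_ac)
  also have "(\<Sum>k\<le>Suc n. real (Suc n choose k) * bernoulli k * (real (Suc n - k) * x ^ (Suc n - k - 1)))
      = (\<Sum>k\<le>n. real (Suc n) * (real (n choose k) * bernoulli k * x ^ (n - k)))"
  proof -
    have "real (Suc n choose k) * real (Suc n - k) = real (Suc n) * real (n choose k)" if "k \<le> n" for k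
    proof -
      have "(Suc n choose k) * (Suc n - k) = Suc n * (n choose k)"
        using binomial_absorb_comp[of "Suc n" k] by (simp add: mult.commute)
      then show ?thesis
        by (metis of_nat_mult)
    qed
    then have eq: "real (Suc n choose k) * bernoulli k * (real (Suc n - k) * x ^ (Suc n - k - 1))
        = real (Suc n) * (real (n choose k) * bernoulli k * x ^ (n - k))" if "k \<le> n" for k
      using that by (simp add: mult_ac)
    have "(\<Sum>k\<le>Suc n. real (Suc n choose k) * bernoulli k * (real (Suc n - k) * x ^ (Suc n - k - 1)))
        = (\<Sum>k\<le>n. real (Suc n choose k) * bernoulli k * (real (Suc n - k) * x ^ (Suc n - k - 1)))"
      by (subst sum.atMost_Suc) simp
    also have "\<dots> = (\<Sum>k\<le>n. real (Suc n) * (real (n choose k) * bernoulli k * x ^ (n - k)))"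
      by (intro sum.cong refl eq) simp
    finally show ?thesis .
  qed
  finally show ?thesis
    unfolding bernpoly_def[abs_def] sum_distrib_left .
qed

lemma bernpoly_0_left: "bernpoly 0 x = 1"
  by (simp add: bernpoly_def)

lemma bernpoly_1_left: "bernpoly (Suc 0) x = x - 1/2"
  by (simp add: bernpoly_def)

lemma bernpoly_1_eq_0:
  "bernpoly (Suc n) 1 = bernpoly (Suc n) 0 + (if n = 0 then 1 else 0)"
proof (cases n)
  case 0
  then show ?thesis by (simp add: bernpoly_1_left)
next
  case (Suc m)
  have "(\<Sum>k\<le>Suc m. real (m + 2 choose k) * bernoulli k) = 0"
    by (simp add: field_simps)
  moreover have "(\<Sum>k\<le>Suc (Suc m). real (Suc (Suc m) choose k) * bernoulli k * 0 ^ (Suc (Suc m) - k)) 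
      = bernoulli (Suc (Suc m))"
    by (subst sum.remove[of _ "Suc (Suc m)"]) (auto intro!: sum.neutral)
  ultimately show ?thesis
    unfolding bernpoly_def Suc by (simp del: bernoulli.simps)
qed

lemma continuous_on_bernpoly: "continuous_on S (bernpoly n)"
  unfolding bernpoly_def[abs_def] by (intro continuous_intros)

text \<open>The Bernoulli polynomials and their periodic continuations, divided by \<open>n!\<close>, so that
  differentiation lowers the index.\<close>
definition nbern :: "nat \<Rightarrow> real \<Rightarrow> real" where
  "nbern n x = bernpoly n x / fact n"

definition pnbern :: "nat \<Rightarrow> real \<Rightarrow> real" where
  "pnbern n x = pbernpoly n x / fact n"

lemma has_field_derivative_nbern:
  "(nbern (Suc n) has_real_derivative nbern n x) (at x within S)"
proof -
  have "((\<lambda>x. bernpoly (Suc n) x / fact (Suc n)) has_real_derivative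
      real (Suc n) * bernpoly n x / fact (Suc n)) (at x within S)"
    by (intro DERIV_cdivide has_field_derivative_bernpoly)
  then show ?thesis
    by (simp add: nbern_def[abs_def] field_simps del: of_nat_Suc)
qed

lemma nbern_1_eq_0: "nbern (Suc n) 1 = nbern (Suc n) 0 + (if n = 0 then 1 else 0)"
  by (simp add: nbern_def bernpoly_1_eq_0 add_divide_distrib)

lemma continuous_on_nbern: "continuous_on S (nbern n)"
  unfolding nbern_def[abs_def] by (intro continuous_intros continuous_on_bernpoly) auto

lemma pnbern_eq: "pnbern n x = nbern n (frac x)"
  by (simp add: pnbern_def nbern_def pbernpoly_def)

lemma pnbern_measurable [measurable]: "pnbern n \<in> borel_measurable borel"
proof -
  have "nbern n \<in> borel_measurable borel"
    by (intro borel_measurable_continuous_onI continuous_on_nbern)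
  moreover have "(frac :: real \<Rightarrow> real) \<in> borel_measurable borel"
    unfolding frac_def[abs_def] by measurable
  ultimately show ?thesis
    unfolding pnbern_eq[abs_def] by measurable
qed

lemma pnbern_bounded: obtains C where "C > 0" "\<And>x. \<bar>pnbern n x\<bar> \<le> C"
proof -
  have "bounded (nbern n ` {0..1})"
    by (intro compact_imp_bounded compact_continuous_image continuous_on_nbern) auto
  then obtain C where C: "C > 0" "\<And>x. x \<in> {0..1} \<Longrightarrow> \<bar>nbern n x\<bar> \<le> C"
    by (auto simp: bounded_pos)
  have "\<bar>pnbern n x\<bar> \<le> C" for x
    unfolding pnbern_eq by (rule C(2)) (simp add: frac_lt_1 less_imp_le)
  with C(1) show ?thesis by (rule that)
qed

text \<open>\<open>g\<close> is absolutely continuous on \<open>[0,1]\<close> and \<open>g'\<close> is almost everywhere its derivative,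
  one-sided at the end points.\<close>
definition has_ac_derivative :: "(real \<Rightarrow> real) \<Rightarrow> (real \<Rightarrow> real) \<Rightarrow> bool" where
  "has_ac_derivative g g' \<longleftrightarrow> abs_continuous_on {0..1} g \<and>
     (AE t in lborel. t \<in> {0..1} \<longrightarrow> (g has_real_derivative g' t) (at t within {0..1}))"

lemma has_ac_derivativeE:
  assumes "has_ac_derivative g g'"
  obtains N where "negligible N" "\<And>t. t \<in> {0..1} - N \<Longrightarrow> (g has_real_derivative g' t) (at t within {0..1})"
proof -
  have "AE t in lborel. t \<in> {0..1} \<longrightarrow> (g has_real_derivative g' t) (at t within {0..1})"
    using assms by (simp add: has_ac_derivative_def)
  then obtain N where N: "N \<in> null_sets lborel"
    "{t \<in> space lborel. \<not> (t \<in> {0..1} \<longrightarrow> (g has_real_derivative g' t) (at t within {0..1}))} \<subseteq> N"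
    unfolding eventually_ae_filter by blast
  then have "negligible N"
    by (simp add: negligible_iff_null_sets null_sets_completionI)
  then show ?thesis
    by (rule that) (use N in auto)
qed

lemma has_ac_derivative_integration_by_parts:
  assumes g: "has_ac_derivative g g'" and ab: "0 \<le> a" "a \<le> b" "b \<le> 1"
    and q: "\<And>t. (q has_real_derivative q' t) (at t)" and q': "continuous_on {a..b} q'"
  shows "((\<lambda>t. q t * g' t + q' t * g t) has_integral (q b * g b - q a * g a)) {a..b}"
proof -
  obtain N where N: "negligible N"
    "\<And>t. t \<in> {0..1} - N \<Longrightarrow> (g has_real_derivative g' t) (at t within {0..1})"
    by (rule has_ac_derivativeE[OF g]) (rule that)
  have sub: "{a..b} \<subseteq> {0..1}"
    using ab by auto
  have g_ac: "abs_continuous_on {a..b} g"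
    using g sub by (auto simp: has_ac_derivative_def intro: abs_continuous_on_subset)
  have "bounded (q' ` {a..b})"
    using q' by (intro compact_imp_bounded compact_continuous_image) auto
  then obtain C where C: "C > 0" "\<And>t. t \<in> {a..b} \<Longrightarrow> \<bar>q' t\<bar> \<le> C"
    by (auto simp: bounded_pos)
  have "C-lipschitz_on {a..b} q"
  proof (rule bounded_derivative_imp_lipschitz)
    fix t assume t: "t \<in> {a..b}"
    show "(q has_derivative (*) (q' t)) (at t within {a..b})"
      using q has_field_derivative_at_within unfolding has_field_derivative_def by blast
    show "onorm ((*) (q' t)) \<le> C"
      using C t by (intro onorm_bound) (auto simp: abs_mult intro: mult_right_mono)
  qed (use C in auto)
  then have q_ac: "abs_continuous_on {a..b} q"
    by (rule lipschitz_on_imp_abs_continuous_on)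
  show ?thesis
  proof (rule fundamental_theorem_of_calculus_abs_continuous[OF ab(2) _ N(1)])
    show "abs_continuous_on {a..b} (\<lambda>t. q t * g t)"
      using q_ac g_ac by (rule abs_continuous_on_mult)
    fix t assume t: "t \<in> {a..b} - N"
    have "(g has_real_derivative g' t) (at t within {a..b})"
      using N(2)[of t] t sub by (auto intro: has_field_derivative_subset)
    moreover have "(q has_real_derivative q' t) (at t within {a..b})"
      using q by (rule has_field_derivative_at_within)
    ultimately show "((\<lambda>t. q t * g t) has_real_derivative q t * g' t + q' t * g t) (at t within {a..b})"
      by (auto intro!: derivative_eq_intros)
  qed
qed

lemma has_ac_derivative_FTC:
  assumes g: "has_ac_derivative g g'" and g': "integrable (lebesgue_on {0..1}) g'" and s: "s \<in> {0..1}"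
  shows "g s = g 0 + (LINT t|lebesgue_on {0..1}. indicator {0..s} t * g' t)"
proof -
  have "(g' has_integral (g s - g 0)) {0..s}"
    using has_ac_derivative_integration_by_parts[OF g, of 0 s "\<lambda>_. 1" "\<lambda>_. 0"] s by simp
  then have "((\<lambda>t. if t \<in> {0..s} then g' t else 0) has_integral (g s - g 0)) {0..1}"
    using s by (subst has_integral_restrict) auto
  also have "(\<lambda>t. if t \<in> {0..s} then g' t else 0) = (\<lambda>t. indicator {0..s} t * g' t)"
    by (auto simp: indicator_def)
  finally have 1: "((\<lambda>t. indicator {0..s} t * g' t) has_integral (g s - g 0)) {0..1}" .
  have "integrable (lebesgue_on {0..1}) (\<lambda>t. indicator {0..s} t *\<^sub>R g' t)"
  proof (rule integrable_mult_indicator[OF _ g'])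
    show "{0..s} \<in> sets (lebesgue_on {0..1})"
      using s by (subst sets_restrict_space_iff) auto
  qed
  then have "((\<lambda>t. indicator {0..s} t * g' t) has_integral (LINT t|lebesgue_on {0..1}. indicator {0..s} t * g' t)) {0..1}"
    by (intro has_integral_integral_lebesgue_on) auto
  from has_integral_unique[OF this 1] show ?thesis
    by simp
qed

lemma has_ac_derivative_integrable:
  assumes "has_ac_derivative g g'"
  shows "integrable (lebesgue_on {0..1}) g"
  using assms unfolding has_ac_derivative_def
  by (intro continuous_imp_integrable_real abs_continuous_on_imp_continuous_on) auto

lemma pnbern_integrable:
  assumes "integrable (lebesgue_on {0..1}) g"
  shows "integrable (lebesgue_on {0..1}) (\<lambda>t. pnbern n (x - t) * g t)"
proof -
  obtain C where C: "C > 0" "\<And>x. \<bar>pnbern n x\<bar> \<le> C"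
    using pnbern_bounded[of n] by blast
  have [measurable]: "g \<in> borel_measurable (lebesgue_on {0..1})"
    using assms by auto
  have "(\<lambda>t. pnbern n (x - t)) \<in> borel_measurable lborel"
    by measurable
  then have [measurable]: "(\<lambda>t. pnbern n (x - t)) \<in> borel_measurable (lebesgue_on {0..1})"
    by (intro measurable_restrict_space1 measurable_completion)
  show ?thesis
  proof (rule Bochner_Integration.integrable_bound)
    show "integrable (lebesgue_on {0..1}) (\<lambda>t. C * g t)"
      using assms by simp
    show "AE t in lebesgue_on {0..1}. norm (pnbern n (x - t) * g t) \<le> norm (C * g t)"
      using C by (intro AE_I2) (auto simp: abs_mult intro!: mult_right_mono)
  qed measurable
qed

text \<open>Integration by parts against the periodic kernel.  The additional term \<open>g x\<close> for \<open>n = 0\<close> comes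
  from the jump of the first periodic Bernoulli function at the integers.\<close>
lemma has_ac_derivative_kernel:
  assumes g: "has_ac_derivative g g'" and g': "integrable (lebesgue_on {0..1}) g'" and x: "x \<in> {0..1}"
  shows "(LINT t|lebesgue_on {0..1}. pnbern (Suc n) (x - t) * g' t)
      = (LINT t|lebesgue_on {0..1}. pnbern n (x - t) * g t)
        + nbern (Suc n) x * (LINT t|lebesgue_on {0..1}. g' t) - (if n = 0 then g x else 0)"
proof -
  define J where "J = (\<lambda>t. pnbern (Suc n) (x - t) * g' t - pnbern n (x - t) * g t)"
  have int: "integrable (lebesgue_on {0..1}) (\<lambda>t. pnbern (Suc n) (x - t) * g' t)"
    "integrable (lebesgue_on {0..1}) (\<lambda>t. pnbern n (x - t) * g t)"
    by (intro pnbern_integrable g' has_ac_derivative_integrable[OF g])+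
  have c: "continuous_on S (\<lambda>t. - nbern n (c - t))" for S c
    by (intro continuous_intros continuous_on_compose2[OF continuous_on_nbern[of UNIV]]) auto
  have d: "((\<lambda>t. nbern (Suc n) (c - t)) has_real_derivative - nbern n (c - t)) (at t)" for c t
  proof -
    have "((\<lambda>t. c - t) has_real_derivative - 1) (at t)"
      by (auto intro!: derivative_eq_intros)
    from DERIV_chain2[OF has_field_derivative_nbern this] show ?thesis
      by simp
  qed
  \<comment> \<open>The kernel is polynomial on each side of its kink at \<open>t = x\<close>: \<open>frac (x - t)\<close> is
    \<open>x - t\<close> for \<open>0 < t \<le> x\<close> and \<open>x + 1 - t\<close> for \<open>x < t < 1\<close>.\<close>
  have "(J has_integral (nbern (Suc n) 0 * g x - nbern (Suc n) x * g 0)) {0..x}"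
  proof (rule has_integral_spike_finite)
    show "((\<lambda>t. nbern (Suc n) (x - t) * g' t + - nbern n (x - t) * g t) has_integral
        (nbern (Suc n) 0 * g x - nbern (Suc n) x * g 0)) {0..x}"
      using has_ac_derivative_integration_by_parts[OF g _ _ _ d c, of 0 x x] x by simp
    fix t assume "t \<in> {0..x} - {0}"
    then have "frac (x - t) = x - t"
      using x by (simp add: frac_eq)
    then show "J t = nbern (Suc n) (x - t) * g' t + - nbern n (x - t) * g t"
      by (simp add: J_def pnbern_eq)
  qed simp
  moreover have "(J has_integral (nbern (Suc n) x * g 1 - nbern (Suc n) 1 * g x)) {x..1}"
  proof (rule has_integral_spike_finite)
    show "((\<lambda>t. nbern (Suc n) (x + 1 - t) * g' t + - nbern n (x + 1 - t) * g t) has_integral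
        (nbern (Suc n) x * g 1 - nbern (Suc n) 1 * g x)) {x..1}"
      using has_ac_derivative_integration_by_parts[OF g _ _ _ d c, of x 1 "x + 1"] x by simp
    fix t assume t: "t \<in> {x..1} - {x, 1}"
    then have "frac (x + 1 - t) = x + 1 - t"
      using x by (simp add: frac_eq)
    moreover have "frac (x + 1 - t) = frac (x - t)"
      using frac_1_eq[of "x - t"] by (simp add: algebra_simps)
    ultimately show "J t = nbern (Suc n) (x + 1 - t) * g' t + - nbern n (x + 1 - t) * g t"
      by (simp add: J_def pnbern_eq)
  qed simp
  ultimately have "(J has_integral (nbern (Suc n) 0 * g x - nbern (Suc n) x * g 0
      + (nbern (Suc n) x * g 1 - nbern (Suc n) 1 * g x))) {0..1}"
    using x by (intro has_integral_combine[where c=x]) auto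
  moreover have "(J has_integral (LINT t|lebesgue_on {0..1}. J t)) {0..1}"
    unfolding J_def by (intro has_integral_integral_lebesgue_on Bochner_Integration.integrable_diff int) auto
  ultimately have J: "(LINT t|lebesgue_on {0..1}. J t) = nbern (Suc n) 0 * g x - nbern (Suc n) x * g 0
      + (nbern (Suc n) x * g 1 - nbern (Suc n) 1 * g x)"
    by (rule has_integral_unique[symmetric])
  have "(g' has_integral (g 1 - g 0)) {0..1}"
    using has_ac_derivative_integration_by_parts[OF g, of 0 1 "\<lambda>_. 1" "\<lambda>_. 0"] by simp
  moreover have "(g' has_integral (LINT t|lebesgue_on {0..1}. g' t)) {0..1}"
    using g' by (intro has_integral_integral_lebesgue_on) auto
  ultimately have "(LINT t|lebesgue_on {0..1}. g' t) = g 1 - g 0"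
    by (rule has_integral_unique[symmetric])
  then have g1: "g 1 = g 0 + (LINT t|lebesgue_on {0..1}. g' t)"
    by simp
  show ?thesis
    using J unfolding J_def Bochner_Integration.integral_diff[OF int] nbern_1_eq_0 g1
    by (auto simp: algebra_simps)
qed

text \<open>Here \<open>g k\<close> stands for the derivative of order \<open>k\<close> of \<open>g 0\<close>.\<close>
lemma bernoulli_expansion:
  assumes n: "n > 0" and g: "\<And>k. k < n \<Longrightarrow> has_ac_derivative (g k) (g (Suc k))"
    and int: "integrable (lebesgue_on {0..1}) (g n)" and x: "x \<in> {0..1}"
  shows "g 0 x = (\<Sum>k\<le>n. nbern k x * (LINT t|lebesgue_on {0..1}. g k t))
      - (LINT t|lebesgue_on {0..1}. pnbern n (x - t) * g n t)"
  using n g int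
proof (induction n rule: nat_induct_non_zero)
  case 1
  then show ?case
    using has_ac_derivative_kernel[of "g 0" "g 1" x 0] x
    by (simp add: pnbern_def nbern_def pbernpoly_def bernpoly_0_left)
next
  case (Suc n)
  have "integrable (lebesgue_on {0..1}) (g n)"
    using Suc.prems(1)[of n] by (auto intro: has_ac_derivative_integrable)
  then show ?case
    using Suc has_ac_derivative_kernel[of "g n" "g (Suc n)" x n] x by simp
qed

section \<open>Completed product measures and Fubini's theorem\<close>

lemma borel_measurable_completion_AE:
  fixes f g :: "'a \<Rightarrow> real"
  assumes [measurable]: "g \<in> borel_measurable M" and eq: "AE x in M. f x = g x"
  shows "f \<in> borel_measurable (completion M)"
proof (rule measurableI)
  fix A :: "real set" assume [measurable]: "A \<in> sets borel"
  have "g -` A \<inter> space M \<in> sets (completion M)"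
    by (rule sets_completionI_sets) measurable
  moreover have "AE x in completion M. x \<in> g -` A \<inter> space M \<longleftrightarrow> x \<in> f -` A \<inter> space M"
    using AE_completion[OF eq] by eventually_elim auto
  ultimately show "f -` A \<inter> space (completion M) \<in> sets (completion M)"
    by (subst completion.in_sets_AE[of "g -` A \<inter> space M"]) (auto simp: eq_commute)
qed auto

lemma integrable_completion_AE:
  fixes f g :: "'a \<Rightarrow> real"
  assumes g: "integrable M g" and eq: "AE x in M. f x = g x"
  shows "integrable (completion M) f" "integral\<^sup>L (completion M) f = integral\<^sup>L M g"
proof -
  have gm: "g \<in> borel_measurable M"
    using g by auto
  have gm': "g \<in> borel_measurable (completion M)"
    using gm by (rule measurable_completion)
  have f: "f \<in> borel_measurable (completion M)"
    using borel_measurable_completion_AE[OF gm eq] .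
  have ae: "AE x in completion M. f x = g x"
    using eq by (rule AE_completion)
  show "integrable (completion M) f"
    using integrable_cong_AE[OF f gm' ae] g gm by (simp add: integrable_completion)
  show "integral\<^sup>L (completion M) f = integral\<^sup>L M g"
    using integral_cong_AE[OF f gm' ae] gm by (simp add: integral_completion)
qed

text \<open>Functions integrable with respect to a completion are, up to null sets, the functions
  integrable with respect to the measure itself.\<close>
lemma integrable_completionE:
  fixes f :: "'a \<Rightarrow> real"
  assumes "integrable (completion M) f"
  obtains g where "integrable M g" "AE x in M. f x = g x" "integral\<^sup>L (completion M) f = integral\<^sup>L M g"
proof -
  have f: "f \<in> borel_measurable (completion M)"
    using assms by auto
  obtain g where g: "g \<in> borel_measurable M" and eq: "AE x in M. f x = g x"
    using completion_ex_borel_measurable_real[OF f] by blast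
  have "integrable (completion M) g"
    using integrable_cong_AE[OF f measurable_completion[OF g] AE_completion[OF eq]] assms by simp
  then have "integrable M g"
    using g by (simp add: integrable_completion)
  then show ?thesis
    using that[OF _ eq] integrable_completion_AE(2)[OF _ eq] by blast
qed

lemma integrable_completion_cong_AE:
  fixes f g :: "'a \<Rightarrow> real"
  assumes f: "integrable (completion M) f" and eq: "AE x in M. g x = f x"
  shows "integrable (completion M) g" "integral\<^sup>L (completion M) g = integral\<^sup>L (completion M) f"
proof -
  obtain h where h: "integrable M h" "AE x in M. f x = h x" "integral\<^sup>L (completion M) f = integral\<^sup>L M h"
    using f by (rule integrable_completionE)
  have "AE x in M. g x = h x"
    using eq h(2) by eventually_elim simp
  from integrable_completion_AE[OF h(1) this] h(3)
  show "integrable (completion M) g" "integral\<^sup>L (completion M) g = integral\<^sup>L (completion M) f"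
    by auto
qed

lemma completion_restrict_space:
  assumes S: "S \<in> sets M"
  shows "completion (restrict_space M S) = restrict_space (completion M) S"
proof (rule measure_eqI)
  have eq: "A \<in> sets (completion (restrict_space M S)) \<longleftrightarrow> A \<in> sets (completion M) \<and> A \<subseteq> S" for A
  proof
    assume "A \<in> sets (completion (restrict_space M S))"
    then obtain B N N' where *: "A = B \<union> N" "N \<subseteq> N'" "N' \<in> null_sets (restrict_space M S)"
      "B \<in> sets (restrict_space M S)"
      by (rule sets_completionE)
    then have "N' \<in> null_sets M" "N' \<subseteq> S" "B \<in> sets M" "B \<subseteq> S"
      using S by (auto simp: null_sets_restrict_space sets_restrict_space_iff)
    then show "A \<in> sets (completion M) \<and> A \<subseteq> S"
      using * by (auto intro: sets_completionI)
  next
    assume A: "A \<in> sets (completion M) \<and> A \<subseteq> S"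
    then obtain B N N' where *: "A = B \<union> N" "N \<subseteq> N'" "N' \<in> null_sets M" "B \<in> sets M"
      by (auto elim: sets_completionE)
    then have "N' \<inter> S \<in> null_sets (restrict_space M S)" "B \<in> sets (restrict_space M S)"
      using S A by (auto simp: null_sets_restrict_space sets_restrict_space_iff null_set_Int2)
    then show "A \<in> sets (completion (restrict_space M S))"
      using * A by (intro sets_completionI[of A B N "N' \<inter> S"]) auto
  qed
  then show sets: "sets (completion (restrict_space M S)) = sets (restrict_space (completion M) S)"
    using S by (auto simp: sets_restrict_space_iff)
  fix A assume A: "A \<in> sets (completion (restrict_space M S))"
  then obtain B N N' where *: "A = B \<union> N" "N \<subseteq> N'" "N' \<in> null_sets (restrict_space M S)"
      "B \<in> sets (restrict_space M S)"
    by (rule sets_completionE)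
  then have M: "N' \<in> null_sets M" "N' \<subseteq> S" "B \<in> sets M" "B \<subseteq> S"
    using S by (auto simp: null_sets_restrict_space sets_restrict_space_iff)
  have N: "N \<in> null_sets (completion (restrict_space M S))" "N \<in> null_sets (completion M)"
    using * M by (auto simp: null_sets_completion_iff2)
  have "emeasure (completion (restrict_space M S)) A = emeasure (restrict_space M S) B"
    using * N(1) by (simp add: emeasure_Un_null_set)
  also have "\<dots> = emeasure (completion M) A"
    using * N(2) M S by (simp add: emeasure_Un_null_set emeasure_restrict_space)
  also have "\<dots> = emeasure (restrict_space (completion M) S) A"
    using A eq S by (simp add: emeasure_restrict_space)
  finally show "emeasure (completion (restrict_space M S)) A = emeasure (restrict_space (completion M) S) A" .
qed

text \<open>Borel-Lebesgue measure on \<open>[0,1]\<close> and on \<open>[0,1]\<^sup>B\<close>, whose completions are \<open>lebesgue_on {0..1}\<close> and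
  \<open>cube_lebesgue B\<close>.\<close>
abbreviation unit_lborel :: "real measure" where
  "unit_lborel \<equiv> restrict_space lborel {0..1}"

abbreviation cube_lborel :: "nat set \<Rightarrow> (nat \<Rightarrow> real) measure" where
  "cube_lborel B \<equiv> PiM B (\<lambda>_. unit_lborel)"

lemma completion_unit_lborel: "completion unit_lborel = lebesgue_on {0..1}"
  by (rule completion_restrict_space) simp

lemma prob_space_unit_lborel: "prob_space unit_lborel"
  by (rule prob_spaceI) (simp add: emeasure_restrict_space space_restrict_space)

lemma prob_space_cube_lborel: "prob_space (cube_lborel B)"
  by (intro prob_space_PiM prob_space_unit_lborel)

lemma prob_space_cube_lebesgue: "prob_space (cube_lebesgue B)"
  unfolding cube_lebesgue_def by (intro prob_space.prob_space_completion prob_space_cube_lborel)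

lemma AE_cube_lebesgue: "(AE y in cube_lebesgue B. P y) \<longleftrightarrow> (AE y in cube_lborel B. P y)"
  unfolding cube_lebesgue_def by (rule AE_completion_iff)

lemma space_cube_lebesgue: "space (cube_lebesgue B) = (B \<rightarrow>\<^sub>E {0..1})"
  by (simp add: cube_lebesgue_def space_PiM space_restrict_space)

lemma distr_cube_lborel_insert:
  "distr (unit_lborel \<Otimes>\<^sub>M cube_lborel B) (cube_lborel (insert i B)) (\<lambda>p. (snd p)(i := fst p))
     = cube_lborel (insert i B)"
  using distr_pair_PiM_eq_PiM[of B "\<lambda>_. unit_lborel" i] prob_space_unit_lborel
  by (simp add: split_beta')

lemma measurable_cube_insert:
  "(\<lambda>p. (snd p)(i := fst p)) \<in> unit_lborel \<Otimes>\<^sub>M cube_lborel B \<rightarrow>\<^sub>M cube_lborel (insert i B)"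
  by (rule measurable_fun_upd[where J=B]) auto

lemma AE_cube_lborel_insert:
  assumes "AE z in cube_lborel (insert i B). P z"
  shows "AE y in cube_lborel B. AE t in unit_lborel. P (y(i := t))"
proof -
  interpret U: prob_space unit_lborel by (rule prob_space_unit_lborel)
  interpret C: prob_space "cube_lborel B" by (rule prob_space_cube_lborel)
  interpret S: pair_sigma_finite "cube_lborel B" unit_lborel ..
  interpret S': pair_sigma_finite unit_lborel "cube_lborel B" ..
  have "AE p in unit_lborel \<Otimes>\<^sub>M cube_lborel B. P ((snd p)(i := fst p))"
    by (rule AE_distrD[OF measurable_cube_insert]) (unfold distr_cube_lborel_insert, rule assms)
  then have "AE p in distr (cube_lborel B \<Otimes>\<^sub>M unit_lborel) (unit_lborel \<Otimes>\<^sub>M cube_lborel B) (\<lambda>(y, t). (t, y)).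
      P ((snd p)(i := fst p))"
    by (unfold S'.distr_pair_swap[symmetric])
  from AE_distrD[OF measurable_pair_swap' this]
  have "AE p in cube_lborel B \<Otimes>\<^sub>M unit_lborel. P ((fst p)(i := snd p))"
    by (simp add: split_beta')
  from S.AE_pair[OF this] show ?thesis by simp
qed

lemma cube_lborel_insert_integrable:
  fixes F :: "(nat \<Rightarrow> real) \<Rightarrow> real"
  assumes "integrable (cube_lborel (insert i B)) F"
  shows "AE y in cube_lborel B. integrable unit_lborel (\<lambda>t. F (y(i := t)))"
    "integrable (cube_lborel B) (\<lambda>y. LINT t|unit_lborel. F (y(i := t)))"
    "(LINT z|cube_lborel (insert i B). F z) = (LINT y|cube_lborel B. LINT t|unit_lborel. F (y(i := t)))"
proof -
  interpret U: prob_space unit_lborel by (rule prob_space_unit_lborel)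
  interpret C: prob_space "cube_lborel B" by (rule prob_space_cube_lborel)
  interpret S: pair_sigma_finite unit_lborel "cube_lborel B" ..
  have Fm: "F \<in> borel_measurable (cube_lborel (insert i B))"
    using assms by auto
  have "integrable (unit_lborel \<Otimes>\<^sub>M cube_lborel B) (\<lambda>p. F ((snd p)(i := fst p)))"
    by (rule integrable_distr[OF measurable_cube_insert]) (unfold distr_cube_lborel_insert, rule assms)
  then have *: "integrable (unit_lborel \<Otimes>\<^sub>M cube_lborel B) (\<lambda>(t, y). F (y(i := t)))"
    by (simp add: split_beta')
  show "AE y in cube_lborel B. integrable unit_lborel (\<lambda>t. F (y(i := t)))"
    "integrable (cube_lborel B) (\<lambda>y. LINT t|unit_lborel. F (y(i := t)))"
    using S.AE_integrable_snd[OF *] S.integrable_snd[OF *] by auto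
  have "(LINT z|cube_lborel (insert i B). F z)
      = (LINT p|(unit_lborel \<Otimes>\<^sub>M cube_lborel B). F ((snd p)(i := fst p)))"
    using integral_distr[OF measurable_cube_insert[of i B] Fm]
    by (simp only: distr_cube_lborel_insert)
  also have "\<dots> = (LINT y|cube_lborel B. LINT t|unit_lborel. F (y(i := t)))"
    using S.integral_snd[OF *] by (simp add: split_beta')
  finally show "(LINT z|cube_lborel (insert i B). F z) = (LINT y|cube_lborel B. LINT t|unit_lborel. F (y(i := t)))" .
qed

text \<open>Fubini's theorem for the completed measures.  A function on the completed product need not
  have measurable sections; it is compared with a Borel function, whose sections agree with
  its own for almost every \<open>y\<close>.\<close>
lemma cube_lebesgue_insert_integrable:
  fixes F :: "(nat \<Rightarrow> real) \<Rightarrow> real"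
  assumes "integrable (cube_lebesgue (insert i B)) F"
  shows "AE y in cube_lborel B. integrable (lebesgue_on {0..1}) (\<lambda>t. F (y(i := t)))"
    "integrable (cube_lebesgue B) (\<lambda>y. LINT t|lebesgue_on {0..1}. F (y(i := t)))"
    "(LINT z|cube_lebesgue (insert i B). F z) = (LINT y|cube_lebesgue B. LINT t|lebesgue_on {0..1}. F (y(i := t)))"
proof -
  obtain G where G: "integrable (cube_lborel (insert i B)) G" "AE z in cube_lborel (insert i B). F z = G z"
    "(LINT z|cube_lebesgue (insert i B). F z) = (LINT z|cube_lborel (insert i B). G z)"
    using assms unfolding cube_lebesgue_def by (rule integrable_completionE)
  note G' = cube_lborel_insert_integrable[OF G(1)]
  have ae: "AE y in cube_lborel B. integrable (lebesgue_on {0..1}) (\<lambda>t. F (y(i := t))) \<and>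
      (LINT t|lebesgue_on {0..1}. F (y(i := t))) = (LINT t|unit_lborel. G (y(i := t)))"
    using G'(1) AE_cube_lborel_insert[OF G(2)]
  proof eventually_elim
    case (elim y)
    from integrable_completion_AE[OF this] show ?case
      by (simp add: completion_unit_lborel)
  qed
  then show "AE y in cube_lborel B. integrable (lebesgue_on {0..1}) (\<lambda>t. F (y(i := t)))"
    by eventually_elim auto
  have ae': "AE y in cube_lborel B. (LINT t|lebesgue_on {0..1}. F (y(i := t))) = (LINT t|unit_lborel. G (y(i := t)))"
    using ae by eventually_elim auto
  from integrable_completion_AE[OF G'(2) ae']
  show "integrable (cube_lebesgue B) (\<lambda>y. LINT t|lebesgue_on {0..1}. F (y(i := t)))"
    "(LINT z|cube_lebesgue (insert i B). F z) = (LINT y|cube_lebesgue B. LINT t|lebesgue_on {0..1}. F (y(i := t)))"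
    by (simp_all add: cube_lebesgue_def[symmetric] G(3) G'(3))
qed

lemma integrable_cube_lebesgue_empty: "integrable (cube_lebesgue {}) (F :: _ \<Rightarrow> real)"
proof -
  interpret prob_space "cube_lebesgue {}"
    by (rule prob_space_cube_lebesgue)
  have "integrable (cube_lebesgue {}) F \<longleftrightarrow> integrable (cube_lebesgue {}) (\<lambda>_. F (\<lambda>_. undefined))"
    by (intro Bochner_Integration.integrable_cong) (auto simp: space_cube_lebesgue)
  then show ?thesis
    by simp
qed

text \<open>The projection from \<open>[0,1]\<^bsup>insert i B\<^esup>\<close> to \<open>[0,1]\<^sup>B\<close> preserves measure.\<close>
lemma integrable_cube_lborel_restrict:
  fixes g :: "(nat \<Rightarrow> real) \<Rightarrow> real"
  assumes "finite B" "i \<notin> B"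
  shows "integrable (cube_lborel B) g \<Longrightarrow> integrable (cube_lborel (insert i B)) (\<lambda>z. g (restrict z B))"
    and "AE y in cube_lborel B. P y \<Longrightarrow> AE z in cube_lborel (insert i B). P (restrict z B)"
proof -
  interpret U: prob_space unit_lborel by (rule prob_space_unit_lborel)
  interpret product_prob_space "\<lambda>_::nat. unit_lborel" "insert i B"
    by unfold_locales
  have *: "cube_lborel B = distr (cube_lborel (insert i B)) (cube_lborel B) (\<lambda>z. restrict z B)"
    using assms by (intro distr_restrict) auto
  have m: "(\<lambda>z. restrict z B) \<in> cube_lborel (insert i B) \<rightarrow>\<^sub>M cube_lborel B"
    by (rule measurable_restrict_subset) auto
  show "integrable (cube_lborel B) g \<Longrightarrow> integrable (cube_lborel (insert i B)) (\<lambda>z. g (restrict z B))"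
    by (rule integrable_distr[OF m]) (unfold *[symmetric])
  show "AE y in cube_lborel B. P y \<Longrightarrow> AE z in cube_lborel (insert i B). P (restrict z B)"
    by (rule AE_distrD[OF m]) (unfold *[symmetric])
qed

section \<open>Integrable functions on cubes\<close>

lemma integrable_cube_pnbern:
  assumes F: "integrable (cube_lebesgue B) F" and j: "j \<in> B"
  shows "integrable (cube_lebesgue B) (\<lambda>z. pnbern n (c - z j) * F z)"
proof -
  obtain C where C: "C > 0" "\<And>x. \<bar>pnbern n x\<bar> \<le> C"
    using pnbern_bounded[of n] by blast
  have "(\<lambda>z. z j) \<in> cube_lborel B \<rightarrow>\<^sub>M unit_lborel"
    using j by (rule measurable_component_singleton)
  then have [measurable]: "(\<lambda>z. z j) \<in> borel_measurable (cube_lborel B)"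
    by (auto simp: measurable_restrict_space2_iff)
  have "(\<lambda>z. pnbern n (c - z j)) \<in> borel_measurable (cube_lborel B)"
    by measurable
  then have [measurable]: "(\<lambda>z. pnbern n (c - z j)) \<in> borel_measurable (cube_lebesgue B)"
    unfolding cube_lebesgue_def by (rule measurable_completion)
  have [measurable]: "F \<in> borel_measurable (cube_lebesgue B)"
    using F by auto
  show ?thesis
  proof (rule Bochner_Integration.integrable_bound)
    show "integrable (cube_lebesgue B) (\<lambda>z. C * F z)"
      using F by simp
    show "AE z in cube_lebesgue B. norm (pnbern n (c - z j) * F z) \<le> norm (C * F z)"
      using C by (intro AE_I2) (auto simp: abs_mult intro!: mult_right_mono)
  qed measurable
qed

lemma integrable_cube_prod_pnbern:
  assumes F: "integrable (cube_lebesgue B) F" and w: "finite w" "w \<subseteq> B"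
  shows "integrable (cube_lebesgue B) (\<lambda>z. (\<Prod>j\<in>w. pnbern n (x j - z j)) * F z)"
  using w
proof (induction w rule: finite_induct)
  case empty
  then show ?case using F by simp
next
  case (insert j w)
  then show ?case
    using integrable_cube_pnbern[of B "\<lambda>z. (\<Prod>j\<in>w. pnbern n (x j - z j)) * F z" j n "x j"]
    by (simp add: mult.assoc)
qed

text \<open>If a function and its derivative in the coordinate \<open>i\<close> are integrable over the cube, then
  the function is integrable over every slice \<open>y\<^sub>i = c\<close>.  By the expansion of order one, its value at
  \<open>y\<^sub>i = c\<close> is a sum of integrals over the segment in direction \<open>i\<close>.\<close>
lemma integrable_cube_slice:
  assumes \<Phi>: "integrable (cube_lebesgue (insert i B)) \<Phi>" and \<Psi>: "integrable (cube_lebesgue (insert i B)) \<Psi>"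
    and ac: "AE y in cube_lborel B. has_ac_derivative (\<lambda>t. \<Phi> (y(i := t))) (\<lambda>t. \<Psi> (y(i := t)))"
    and c: "c \<in> {0..1}"
  shows "integrable (cube_lebesgue B) (\<lambda>y. \<Phi> (y(i := c)))"
proof -
  define R where "R y = (LINT t|lebesgue_on {0..1}. \<Phi> (y(i := t)))
      + nbern 1 c * (LINT t|lebesgue_on {0..1}. \<Psi> (y(i := t)))
      - (LINT t|lebesgue_on {0..1}. pnbern 1 (c - t) * \<Psi> (y(i := t)))" for y
  note F\<Phi> = cube_lebesgue_insert_integrable[OF \<Phi>]
  note F\<Psi> = cube_lebesgue_insert_integrable[OF \<Psi>]
  have "integrable (cube_lebesgue (insert i B)) (\<lambda>z. pnbern 1 (c - z i) * \<Psi> z)"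
    by (rule integrable_cube_pnbern[OF \<Psi>]) simp
  from cube_lebesgue_insert_integrable(2)[OF this]
  have "integrable (cube_lebesgue B) (\<lambda>y. LINT t|lebesgue_on {0..1}. pnbern 1 (c - t) * \<Psi> (y(i := t)))"
    by simp
  then have R: "integrable (cube_lebesgue B) R"
    unfolding R_def using F\<Phi>(2) F\<Psi>(2) by (intro Bochner_Integration.integrable_diff Bochner_Integration.integrable_add) auto
  have "AE y in cube_lborel B. \<Phi> (y(i := c)) = R y"
    using ac F\<Psi>(1)
  proof eventually_elim
    case (elim y)
    show ?case
      using bernoulli_expansion[of 1 "\<lambda>k. if k = 0 then (\<lambda>t. \<Phi> (y(i := t))) else (\<lambda>t. \<Psi> (y(i := t)))" c] elim c
      by (simp add: R_def nbern_def bernpoly_0_left)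
  qed
  then show ?thesis
    using integrable_completion_cong_AE(1)[OF R[unfolded cube_lebesgue_def]] by (simp add: cube_lebesgue_def)
qed

text \<open>Conversely, a function is integrable over the cube if it is the sum of an integrable function on
  the face \<open>y\<^sub>i = 0\<close> and of the integral of an integrable \<open>\<Psi>\<close> over the segment from that face.\<close>
lemma integrable_cube_primitive:
  fixes \<Phi> \<Psi> \<phi> :: "(nat \<Rightarrow> real) \<Rightarrow> real"
  assumes B: "finite B" "i \<notin> B"
    and \<phi>: "integrable (cube_lebesgue B) \<phi>" and \<Psi>: "integrable (cube_lebesgue (insert i B)) \<Psi>"
    and eq: "AE y in cube_lborel B. \<forall>s\<in>{0..1}.
      \<Phi> (y(i := s)) = \<phi> y + (LINT t|lebesgue_on {0..1}. indicator {0..s} t * \<Psi> (y(i := t)))"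
  shows "integrable (cube_lebesgue (insert i B)) \<Phi>"
proof -
  interpret U: prob_space unit_lborel by (rule prob_space_unit_lborel)
  obtain G0 where G0: "integrable (cube_lborel B) G0" "AE y in cube_lborel B. \<phi> y = G0 y"
    using integrable_completionE[OF \<phi>[unfolded cube_lebesgue_def]] by blast
  obtain G where G: "integrable (cube_lborel (insert i B)) G" "AE z in cube_lborel (insert i B). \<Psi> z = G z"
    using integrable_completionE[OF \<Psi>[unfolded cube_lebesgue_def]] by blast
  have [measurable]: "G \<in> borel_measurable (cube_lborel (insert i B))"
    using G by auto
  \<comment> \<open>Joint measurability is obtained from Borel representatives of \<open>\<phi>\<close> and \<open>\<Psi>\<close>;
    \<open>K\<close> is an integrable majorant of the primitive \<open>H\<close>.\<close>
  define H where "H z = (LINT t|unit_lborel. indicator {0..z i} t * G ((restrict z B)(i := t)))" for z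
  define K where "K y = (LINT t|unit_lborel. \<bar>G (y(i := t))\<bar>)" for y
  have upd: "(\<lambda>p. (restrict (fst p) B)(i := snd p)) \<in> cube_lborel (insert i B) \<Otimes>\<^sub>M unit_lborel \<rightarrow>\<^sub>M cube_lborel (insert i B)"
    by (rule measurable_fun_upd[where J=B])
      (auto intro!: measurable_compose[OF measurable_fst measurable_restrict_subset])
  have comp: "(\<lambda>z. z i) \<in> borel_measurable (cube_lborel (insert i B))"
    using measurable_component_singleton[of i "insert i B" "\<lambda>_. unit_lborel"]
    by (auto simp: measurable_restrict_space2_iff)
  have [measurable]: "(\<lambda>p. fst p i) \<in> borel_measurable (cube_lborel (insert i B) \<Otimes>\<^sub>M unit_lborel)"
    by (rule measurable_compose[OF measurable_fst comp])
  have snd: "snd \<in> borel_measurable (cube_lborel (insert i B) \<Otimes>\<^sub>M unit_lborel)"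
    using measurable_snd[of "cube_lborel (insert i B)" unit_lborel] by (simp add: measurable_restrict_space2_iff)
  have "(\<lambda>p. if 0 \<le> snd p \<and> snd p \<le> fst p i then G ((restrict (fst p) B)(i := snd p)) else 0)
      \<in> borel_measurable (cube_lborel (insert i B) \<Otimes>\<^sub>M unit_lborel)"
    using snd measurable_compose[OF upd \<open>G \<in> borel_measurable _\<close>] by measurable
  also have "(\<lambda>p. if 0 \<le> snd p \<and> snd p \<le> fst p i then G ((restrict (fst p) B)(i := snd p)) else 0)
      = (\<lambda>(z, t). indicator {0..z i} t * G ((restrict z B)(i := t)))"
    by (auto simp: indicator_def)
  finally have Hm: "H \<in> borel_measurable (cube_lborel (insert i B))"
    unfolding H_def by (rule U.borel_measurable_lebesgue_integral)
  have abs: "integrable (cube_lborel (insert i B)) (\<lambda>z. \<bar>G z\<bar>)"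
    using G(1) by simp
  note absG = cube_lborel_insert_integrable[OF abs]
  have "integrable (cube_lborel B) K"
    unfolding K_def using absG(2) .
  then have K: "integrable (cube_lborel (insert i B)) (\<lambda>z. K (restrict z B))"
    by (rule integrable_cube_lborel_restrict(1)[OF B])
  have "integrable (cube_lborel (insert i B)) H"
  proof (rule Bochner_Integration.integrable_bound[OF K Hm])
    show "AE z in cube_lborel (insert i B). norm (H z) \<le> norm (K (restrict z B))"
      using integrable_cube_lborel_restrict(2)[OF B absG(1)]
    proof eventually_elim
      case (elim z)
      have "norm (H z) \<le> (LINT t|unit_lborel. \<bar>indicator {0..z i} t * G ((restrict z B)(i := t))\<bar>)"
        unfolding H_def using integral_norm_bound[of unit_lborel "\<lambda>t. indicator {0..z i} t * G ((restrict z B)(i := t))"] by simp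
      also have "\<dots> \<le> K (restrict z B)"
        unfolding K_def by (rule integral_mono'[OF elim]) (auto simp: indicator_def)
      finally show ?case by simp
    qed
  qed
  moreover have "integrable (cube_lborel (insert i B)) (\<lambda>z. G0 (restrict z B))"
    using G0(1) by (rule integrable_cube_lborel_restrict(1)[OF B])
  ultimately have int: "integrable (cube_lborel (insert i B)) (\<lambda>z. G0 (restrict z B) + H z)"
    by (intro Bochner_Integration.integrable_add)
  have "AE y in cube_lborel B. \<forall>s\<in>{0..1}.
      \<Phi> (y(i := s)) = G0 y + (LINT t|unit_lborel. indicator {0..s} t * G (y(i := t)))"
    using eq G0(2) AE_cube_lborel_insert[OF G(2)] cube_lborel_insert_integrable(1)[OF G(1)]
  proof eventually_elim
    case (elim y)
    show ?case
    proof
      fix s :: real assume s: "s \<in> {0..1}"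
      have "integrable unit_lborel (\<lambda>t. indicator {0..s} t *\<^sub>R G (y(i := t)))"
      proof (rule integrable_mult_indicator[OF _ elim(4)])
        show "{0..s} \<in> sets unit_lborel"
          using s by (subst sets_restrict_space_iff) auto
      qed
      then have "integrable unit_lborel (\<lambda>t. indicator {0..s} t * G (y(i := t)))"
        by simp
      moreover have "AE t in unit_lborel. indicator {0..s} t * \<Psi> (y(i := t)) = indicator {0..s} t * G (y(i := t))"
        using elim(3) by eventually_elim simp
      ultimately have "(LINT t|lebesgue_on {0..1}. indicator {0..s} t * \<Psi> (y(i := t)))
          = (LINT t|unit_lborel. indicator {0..s} t * G (y(i := t)))"
        unfolding completion_unit_lborel[symmetric] by (rule integrable_completion_AE(2))
      then show "\<Phi> (y(i := s)) = G0 y + (LINT t|unit_lborel. indicator {0..s} t * G (y(i := t)))"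
        using elim s by simp
    qed
  qed
  from integrable_cube_lborel_restrict(2)[OF B this] AE_space
  have "AE z in cube_lborel (insert i B). \<Phi> z = G0 (restrict z B) + H z"
  proof eventually_elim
    case (elim z)
    then have z: "z \<in> insert i B \<rightarrow>\<^sub>E {0..1}"
      by (simp add: space_PiM space_restrict_space)
    then have "(restrict z B)(i := z i) = z" "z i \<in> {0..1}"
      by (auto simp: fun_eq_iff restrict_def PiE_def extensional_def)
    then show ?case
      using elim(1) by (metis H_def)
  qed
  from integrable_completion_AE(1)[OF int this] show ?thesis
    by (simp add: cube_lebesgue_def)
qed

section \<open>Integrability of the mixed derivatives\<close>

lemma mixed_deriv_cong:
  assumes "\<And>j. j \<in> {1..d} \<Longrightarrow> \<sigma> j = \<sigma>' j"
  shows "mixed_deriv d \<sigma> f = mixed_deriv d \<sigma>' f"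
  unfolding mixed_deriv_def by (rule foldr_cong) (use assms in auto)

lemma mixed_deriv_0: "mixed_deriv d (\<lambda>_. 0) f = f"
proof -
  have "foldr (\<lambda>j. partial_deriv j ^^ 0) xs f = f" for xs
    by (induction xs) auto
  then show ?thesis
    by (simp add: mixed_deriv_def)
qed

lemma override_on_insert_upd:
  "i \<notin> u \<Longrightarrow> override_on x (y(i := t)) (insert i u) = (override_on x y u)(i := t)"
  by (auto simp: override_on_def fun_eq_iff)

lemma sum_PiE_insert:
  assumes "finite u" "finite S" "i \<notin> u"
  shows "(\<Sum>\<tau>\<in>insert i u \<rightarrow>\<^sub>E S. h \<tau>) = (\<Sum>\<tau>\<in>u \<rightarrow>\<^sub>E S. \<Sum>k\<in>S. h (\<tau>(i := k)))"
proof -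
  have "(\<Sum>\<tau>\<in>insert i u \<rightarrow>\<^sub>E S. h \<tau>) = (\<Sum>p\<in>S \<times> (u \<rightarrow>\<^sub>E S). h ((snd p)(i := fst p)))"
    unfolding PiE_insert_eq
    using inj_combinator[OF assms(3), of "\<lambda>_. S"]
    by (subst sum.reindex) (auto simp: split_beta' o_def)
  also have "\<dots> = (\<Sum>k\<in>S. \<Sum>\<tau>\<in>u \<rightarrow>\<^sub>E S. h (\<tau>(i := k)))"
    by (simp add: sum.cartesian_product split_beta')
  also have "\<dots> = (\<Sum>\<tau>\<in>u \<rightarrow>\<^sub>E S. \<Sum>k\<in>S. h (\<tau>(i := k)))"
    by (rule sum.swap)
  finally show ?thesis .
qed

locale mixed_smooth =
  fixes d \<alpha> :: nat and f :: "(nat \<Rightarrow> real) \<Rightarrow> real"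
  assumes \<alpha>: "\<alpha> > 0" and smooth: "abs_continuous_mixed_derivs d \<alpha> f"
begin

abbreviation cube :: "(nat \<Rightarrow> real) set" where
  "cube \<equiv> {1..d} \<rightarrow>\<^sub>E {0..1}"

text \<open>Multi-indices are functions on all of \<open>nat\<close>, of which only the values on \<open>{1..d}\<close> matter.\<close>
definition multi_index :: "(nat \<Rightarrow> nat) \<Rightarrow> bool" where
  "multi_index \<sigma> \<longleftrightarrow> (\<forall>j\<in>{1..d}. \<sigma> j \<le> \<alpha>)"

text \<open>The coordinates in which the derivative has the highest order, and thus need only exist almost
  everywhere.\<close>
definition top_coords :: "(nat \<Rightarrow> nat) \<Rightarrow> nat set" where
  "top_coords \<sigma> = {j \<in> {1..d}. \<sigma> j = \<alpha>}"

lemma below_top: "multi_index \<sigma> \<Longrightarrow> i \<in> {1..d} \<Longrightarrow> i \<notin> top_coords \<sigma> \<Longrightarrow> \<sigma> i < \<alpha>"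
  unfolding multi_index_def top_coords_def by (simp add: le_neq_implies_less)

lemma mixed_deriv_restrict: "mixed_deriv d (restrict \<sigma> {1..d}) f = mixed_deriv d \<sigma> f"
  by (rule mixed_deriv_cong) simp

lemma upd_cube: "x \<in> cube \<Longrightarrow> i \<in> {1..d} \<Longrightarrow> s \<in> {0..1} \<Longrightarrow> x(i := s) \<in> cube"
  by (auto simp: PiE_iff extensional_def)

text \<open>The regularity hypothesis along the segments in direction \<open>i\<close>, for almost every value of the
  coordinates in \<open>B\<close>; the remaining coordinates are those of \<open>x\<close>.\<close>
lemma has_ac_derivative_mixed_deriv:
  assumes \<sigma>: "multi_index \<sigma>" and i: "i \<in> {1..d}" "\<sigma> i < \<alpha>"
    and B: "top_coords \<sigma> \<subseteq> B" "B \<subseteq> {1..d}" "i \<notin> B" and x: "x \<in> cube"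
  shows "AE y in cube_lborel B. has_ac_derivative
      (\<lambda>t. mixed_deriv d \<sigma> f (override_on x (y(i := t)) (insert i B)))
      (\<lambda>t. mixed_deriv d (\<sigma>(i := Suc (\<sigma> i))) f (override_on x (y(i := t)) (insert i B)))"
proof -
  define \<tau> where "\<tau> = restrict \<sigma> {1..d}"
  have \<tau>: "\<tau> \<in> {1..d} \<rightarrow>\<^sub>E {0..\<alpha>}" "\<tau> i < \<alpha>" "{j\<in>{1..d}. \<tau> j = \<alpha>} \<subseteq> B" "\<tau> i = \<sigma> i"
    using \<sigma> i B by (auto simp: \<tau>_def multi_index_def top_coords_def)
  have D: "mixed_deriv d \<tau> f = mixed_deriv d \<sigma> f"
    "mixed_deriv d (\<tau>(i := Suc (\<tau> i))) f = mixed_deriv d (\<sigma>(i := Suc (\<sigma> i))) f"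
    using i by (auto intro!: mixed_deriv_cong simp: \<tau>_def)
  have "B \<subseteq> {1..d} - {i}"
    using B by auto
  then have "AE y in cube_lebesgue B.
           let g = (\<lambda>t. mixed_deriv d \<tau> f ((override_on x y B)(i := t)));
               g' = (\<lambda>t. mixed_deriv d (\<tau>(i := Suc (\<tau> i))) f ((override_on x y B)(i := t)))
           in abs_continuous_on {0..1} g \<and>
              (if Suc (\<tau> i) < \<alpha>
               then \<forall>t\<in>{0..1}. (g has_real_derivative g' t) (at t within {0..1})
               else AE t in lborel. t \<in> {0..1} \<longrightarrow>
                      (g has_real_derivative g' t) (at t within {0..1}))"
    using conjunct1[OF smooth[unfolded abs_continuous_mixed_derivs_def]] \<tau> i x by blast
  then show ?thesis
    unfolding AE_cube_lebesgue D Let_def override_on_insert_upd[OF B(3)]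
    by eventually_elim (auto simp: has_ac_derivative_def split: if_splits)
qed

text \<open>Downward induction on \<open>B\<close> from the full cube, where integrability is assumed.\<close>
lemma integrable_mixed_deriv_top:
  assumes \<sigma>: "multi_index \<sigma>" and ne: "top_coords \<sigma> \<noteq> {}" 
    and B: "top_coords \<sigma> \<subseteq> B" "B \<subseteq> {1..d}" and x: "x \<in> cube"
  shows "integrable (cube_lebesgue B) (\<lambda>y. mixed_deriv d \<sigma> f (override_on x y B))"
  using \<sigma> ne B
proof (induction "card ({1..d} - B)" arbitrary: B \<sigma>)
  case 0
  then have B: "B = {1..d}"
    by auto
  have "restrict \<sigma> {1..d} \<in> {1..d} \<rightarrow>\<^sub>E {0..\<alpha>}" "\<exists>j\<in>{1..d}. restrict \<sigma> {1..d} j = \<alpha>"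
    using 0 by (auto simp: multi_index_def top_coords_def)
  then have "integrable (cube_lebesgue {1..d}) (mixed_deriv d (restrict \<sigma> {1..d}) f)"
    using conjunct2[OF smooth[unfolded abs_continuous_mixed_derivs_def]] by blast
  then have int: "integrable (cube_lebesgue {1..d}) (mixed_deriv d \<sigma> f)"
    unfolding mixed_deriv_restrict .
  have "override_on x y {1..d} = y" if "y \<in> cube" for y
    using that x by (auto simp: override_on_def fun_eq_iff PiE_iff extensional_def)
  then have "integrable (cube_lebesgue {1..d}) (\<lambda>y. mixed_deriv d \<sigma> f (override_on x y {1..d}))
      \<longleftrightarrow> integrable (cube_lebesgue {1..d}) (mixed_deriv d \<sigma> f)"
    by (intro Bochner_Integration.integrable_cong refl) (simp add: space_cube_lebesgue)
  then show ?case
    using int B by simp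
next
  case (Suc n)
  then have "{1..d} - B \<noteq> {}"
    by (metis card.empty nat.distinct(1))
  then obtain i where i: "i \<in> {1..d}" "i \<notin> B"
    by blast
  have "{1..d} - insert i B = ({1..d} - B) - {i}"
    by auto
  then have n: "n = card ({1..d} - insert i B)"
    using Suc(2) i by simp
  have \<sigma>i: "\<sigma> i < \<alpha>"
    using Suc.prems i by (intro below_top) auto
  have s: "multi_index (\<sigma>(i := Suc (\<sigma> i)))" "top_coords (\<sigma>(i := Suc (\<sigma> i))) \<noteq> {}"
      "top_coords (\<sigma>(i := Suc (\<sigma> i))) \<subseteq> insert i B"
    using Suc.prems i \<sigma>i by (auto simp: multi_index_def top_coords_def)
  have 1: "integrable (cube_lebesgue (insert i B)) (\<lambda>y. mixed_deriv d \<sigma> f (override_on x y (insert i B)))"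
    using Suc.prems i n by (intro Suc.hyps(1)) auto
  have 2: "integrable (cube_lebesgue (insert i B))
      (\<lambda>y. mixed_deriv d (\<sigma>(i := Suc (\<sigma> i))) f (override_on x y (insert i B)))"
    using Suc.prems i s n by (intro Suc.hyps(1)) auto
  have "x i \<in> {0..1}"
    using x i by auto
  from integrable_cube_slice[OF 1 2
      has_ac_derivative_mixed_deriv[OF Suc.prems(1) i(1) \<sigma>i Suc.prems(3,4) i(2) x] this]
  have "integrable (cube_lebesgue B) (\<lambda>y. mixed_deriv d \<sigma> f ((override_on x y B)(i := x i)))"
    by (simp only: override_on_insert_upd[OF i(2)])
  moreover have "(override_on x y B)(i := x i) = override_on x y B" for y
    using i by (auto simp: override_on_def)
  ultimately show ?case
    by simp
qed

lemma integrable_mixed_deriv: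
  assumes \<sigma>: "multi_index \<sigma>" and B: "top_coords \<sigma> \<subseteq> B" "B \<subseteq> {1..d}" and x: "x \<in> cube"
  shows "integrable (cube_lebesgue B) (\<lambda>y. mixed_deriv d \<sigma> f (override_on x y B))"
proof (cases "top_coords \<sigma> = {}")
  case False
  then show ?thesis
    using integrable_mixed_deriv_top assms by blast
next
  case True
  with \<sigma> show ?thesis
    using B(2) x
  proof (induction "\<Sum>j\<in>{1..d}. \<alpha> - \<sigma> j" arbitrary: \<sigma> B x rule: less_induct)
    case less
    have "finite B"
      using less.prems(3) finite_subset by blast
    then show ?case
      using less.prems(3,4)
    \<comment> \<open>The outer induction provides \<open>\<sigma> + e\<^sub>i\<close> in place of \<open>\<sigma>\<close>, the inner one the face \<open>y\<^sub>i = 0\<close>.\<close>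
    proof (induction B arbitrary: x rule: finite_induct)
      case empty
      show ?case
        by (rule integrable_cube_lebesgue_empty)
    next
      case (insert i B)
      have i: "i \<in> {1..d}" "B \<subseteq> {1..d}"
        using insert.prems by auto
      have \<sigma>i: "\<sigma> i < \<alpha>"
        using less.prems(1,2) i by (intro below_top) auto
      define \<sigma>' where "\<sigma>' = \<sigma>(i := Suc (\<sigma> i))"
      have \<sigma>': "multi_index \<sigma>'"
        using less.prems i \<sigma>i by (auto simp: multi_index_def \<sigma>'_def)
      have top: "top_coords \<sigma>' \<subseteq> insert i B"
        using less.prems(2) by (auto simp: top_coords_def \<sigma>'_def)
      have lt: "(\<Sum>j\<in>{1..d}. \<alpha> - \<sigma>' j) < (\<Sum>j\<in>{1..d}. \<alpha> - \<sigma> j)"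
        using i \<sigma>i by (intro sum_strict_mono_ex1) (auto simp: \<sigma>'_def)
      have \<Psi>: "integrable (cube_lebesgue (insert i B)) (\<lambda>y. mixed_deriv d \<sigma>' f (override_on x y (insert i B)))"
      proof (cases "top_coords \<sigma>' = {}")
        case True
        then show ?thesis
          using less.hyps[OF lt \<sigma>' True] insert.prems by blast
      next
        case False
        then show ?thesis
          using integrable_mixed_deriv_top[OF \<sigma>' False top] insert.prems by blast
      qed
      have x0: "x(i := 0) \<in> cube"
        using insert.prems i by (intro upd_cube) auto
      have \<phi>: "integrable (cube_lebesgue B) (\<lambda>y. mixed_deriv d \<sigma> f (override_on (x(i := 0)) y B))"
        using insert.IH[OF i(2) x0] .
      have "top_coords \<sigma> \<subseteq> B"
        using less.prems(2) by simp
      from has_ac_derivative_mixed_deriv[OF less.prems(1) i(1) \<sigma>i this i(2) insert.hyps(2) insert.prems(2)]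
        cube_lebesgue_insert_integrable(1)[OF \<Psi>]
      have "AE y in cube_lborel B. \<forall>s\<in>{0..1}.
          mixed_deriv d \<sigma> f (override_on x (y(i := s)) (insert i B))
          = mixed_deriv d \<sigma> f (override_on (x(i := 0)) y B)
            + (LINT t|lebesgue_on {0..1}. indicator {0..s} t *
                mixed_deriv d \<sigma>' f (override_on x (y(i := t)) (insert i B)))"
      proof eventually_elim
        case (elim y)
        have eq: "override_on (x(i := 0)) y B = override_on x (y(i := 0)) (insert i B)"
          using insert.hyps by (auto simp: override_on_def fun_eq_iff)
        show ?case
          unfolding eq by (intro ballI has_ac_derivative_FTC[OF elim(1)[folded \<sigma>'_def] elim(2)])
      qed
      from integrable_cube_primitive[OF insert.hyps \<phi> \<Psi> this] show ?case .
    qed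
  qed
qed

section \<open>Splitting off one coordinate\<close>

text \<open>The order of differentiation is given by \<open>\<tau>\<close> on \<open>u\<close>, is \<open>\<alpha>\<close> on \<open>w\<close>, and is zero elsewhere.\<close>
definition mixed_index :: "nat set \<Rightarrow> nat set \<Rightarrow> (nat \<Rightarrow> nat) \<Rightarrow> nat \<Rightarrow> nat" where
  "mixed_index u w \<tau> = (\<lambda>j. if j \<in> u then \<tau> j else if j \<in> w then \<alpha> else 0)"

text \<open>The integral over the coordinates in \<open>u \<union> w\<close>, with remainder kernels in the coordinates in \<open>w\<close>
  and the other coordinates fixed at \<open>x\<close>.\<close>
definition mixed_term :: "(nat \<Rightarrow> real) \<Rightarrow> nat set \<Rightarrow> nat set \<Rightarrow> (nat \<Rightarrow> nat) \<Rightarrow> real" where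
  "mixed_term x u w \<tau> = (LINT y|cube_lebesgue (u \<union> w).
      (\<Prod>j\<in>w. pnbern \<alpha> (x j - y j)) * mixed_deriv d (mixed_index u w \<tau>) f (override_on x y (u \<union> w)))"

text \<open>The result of applying the Bernoulli sum in the coordinates in \<open>u\<close> and the remainder term
  (without its sign) in those in \<open>w\<close>.\<close>
definition mixed_sum :: "(nat \<Rightarrow> real) \<Rightarrow> nat set \<Rightarrow> nat set \<Rightarrow> real" where
  "mixed_sum x u w = (\<Sum>\<tau>\<in>u \<rightarrow>\<^sub>E {0..\<alpha>}. (\<Prod>j\<in>u. nbern (\<tau> j) (x j)) * mixed_term x u w \<tau>)"

text \<open>The expansion in the coordinate \<open>i\<close>, integrated over the coordinates in \<open>u \<union> w\<close>.\<close>
lemma mixed_term_split: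
  assumes x: "x \<in> cube" and i: "i \<in> {1..d}" "i \<notin> u" "i \<notin> w" and u: "u \<subseteq> {1..d}" and w: "w \<subseteq> {1..d}"
    and \<tau>: "\<tau> \<in> u \<rightarrow>\<^sub>E {0..\<alpha>}"
  shows "mixed_term x u w \<tau> = (\<Sum>k\<le>\<alpha>. nbern k (x i) * mixed_term x (insert i u) w (\<tau>(i := k)))
      - mixed_term x u (insert i w) \<tau>"
proof -
  define B where "B = u \<union> w"
  define \<sigma> where "\<sigma> = mixed_index u w \<tau>"
  define W where "W y = (\<Prod>j\<in>w. pnbern \<alpha> (x j - y j))" for y
  define g where "g k z = mixed_deriv d (\<sigma>(i := k)) f (override_on x z (insert i B))" for k z
  have fin: "finite w" and B: "B \<subseteq> {1..d}" "i \<notin> B" "insert i B \<subseteq> {1..d}" and xi: "x i \<in> {0..1}"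
    using x i u w finite_subset[OF w] by (auto simp: B_def)
  have W_upd: "W (y(i := t)) = W y" for y t
    unfolding W_def using i by (intro prod.cong) auto
  have idx: "multi_index (\<sigma>(i := k))" "top_coords (\<sigma>(i := k)) \<subseteq> insert i B" if "k \<le> \<alpha>" for k
    using \<tau> that \<alpha> by (auto simp: \<sigma>_def mixed_index_def multi_index_def top_coords_def B_def)
  have g_int: "integrable (cube_lebesgue (insert i B)) (g k)" if "k \<le> \<alpha>" for k
    unfolding g_def using idx[OF that] B x by (intro integrable_mixed_deriv)
  have Wg_int: "integrable (cube_lebesgue (insert i B)) (\<lambda>z. W z * g k z)" if "k \<le> \<alpha>" for k
    unfolding W_def using fin g_int[OF that] by (intro integrable_cube_prod_pnbern) (auto simp: B_def)
  have pWg_int: "integrable (cube_lebesgue (insert i B)) (\<lambda>z. pnbern \<alpha> (x i - z i) * (W z * g \<alpha> z))"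
    by (intro integrable_cube_pnbern Wg_int) auto
  define I where "I k y = (LINT t|lebesgue_on {0..1}. W (y(i := t)) * g k (y(i := t)))" for k y
  define R where "R y = (LINT t|lebesgue_on {0..1}. pnbern \<alpha> (x i - t) * (W (y(i := t)) * g \<alpha> (y(i := t))))" for y
  have I: "integrable (cube_lebesgue B) (I k)"
    "(LINT z|cube_lebesgue (insert i B). W z * g k z) = (LINT y|cube_lebesgue B. I k y)" if "k \<le> \<alpha>" for k
    unfolding I_def using cube_lebesgue_insert_integrable(2,3)[OF Wg_int[OF that]] by auto
  have R: "integrable (cube_lebesgue B) R"
    "(LINT z|cube_lebesgue (insert i B). pnbern \<alpha> (x i - z i) * (W z * g \<alpha> z)) = (LINT y|cube_lebesgue B. R y)"
    unfolding R_def using cube_lebesgue_insert_integrable(2,3)[OF pWg_int] by auto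
  have ac: "AE y in cube_lborel B. has_ac_derivative (\<lambda>t. g k (y(i := t))) (\<lambda>t. g (Suc k) (y(i := t)))" if "k < \<alpha>" for k
  proof -
    have "top_coords (\<sigma>(i := k)) \<subseteq> B"
      using idx[of k] that by (auto simp: top_coords_def)
    from has_ac_derivative_mixed_deriv[OF idx(1) i(1) _ this B(1,2) x] that show ?thesis
      by (simp add: g_def)
  qed
  \<comment> \<open>For almost every \<open>y\<close> the expansion holds along the segment in direction \<open>i\<close>; it is multiplied by
    \<open>W y\<close>, which does not depend on the coordinate \<open>i\<close>, and integrated over \<open>y\<close>.\<close>
  have "AE y in cube_lborel B. \<forall>k\<in>{..<\<alpha>}. has_ac_derivative (\<lambda>t. g k (y(i := t))) (\<lambda>t. g (Suc k) (y(i := t)))"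
    by (intro AE_finite_allI ac) auto
  then have "AE y in cube_lborel B. W y * mixed_deriv d \<sigma> f (override_on x y B)
      = (\<Sum>k\<le>\<alpha>. nbern k (x i) * I k y) - R y"
    using cube_lebesgue_insert_integrable(1)[OF g_int[OF order_refl]]
  proof eventually_elim
    case (elim y)
    have "\<sigma>(i := 0) = \<sigma>"
      using i by (auto simp: \<sigma>_def mixed_index_def)
    moreover have "override_on x (y(i := x i)) (insert i B) = override_on x y B"
      using B by (auto simp: override_on_def)
    ultimately have "mixed_deriv d \<sigma> f (override_on x y B) = g 0 (y(i := x i))"
      by (simp add: g_def)
    also have "\<dots> = (\<Sum>k\<le>\<alpha>. nbern k (x i) * (LINT t|lebesgue_on {0..1}. g k (y(i := t))))
      - (LINT t|lebesgue_on {0..1}. pnbern \<alpha> (x i - t) * g \<alpha> (y(i := t)))"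
      by (rule bernoulli_expansion[where g = "\<lambda>k t. g k (y(i := t))"]) (use elim \<alpha> xi in auto)
    finally have eq: "mixed_deriv d \<sigma> f (override_on x y B) = \<dots>" .
    have "I k y = W y * (LINT t|lebesgue_on {0..1}. g k (y(i := t)))" for k
      by (simp add: I_def W_upd)
    moreover have "R y = W y * (LINT t|lebesgue_on {0..1}. pnbern \<alpha> (x i - t) * g \<alpha> (y(i := t)))"
      by (simp add: R_def W_upd mult.left_commute)
    ultimately show ?case
      unfolding eq by (simp add: right_diff_distrib sum_distrib_left mult.left_commute)
  qed
  moreover have int: "integrable (cube_lebesgue B) (\<lambda>y. \<Sum>k\<le>\<alpha>. nbern k (x i) * I k y)"
    using I(1) by (intro Bochner_Integration.integrable_sum integrable_mult_right) auto
  then have "integrable (cube_lebesgue B) (\<lambda>y. (\<Sum>k\<le>\<alpha>. nbern k (x i) * I k y) - R y)"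
    using R(1) by (rule Bochner_Integration.integrable_diff)
  ultimately have "mixed_term x u w \<tau>
      = (LINT y|cube_lebesgue B. (\<Sum>k\<le>\<alpha>. nbern k (x i) * I k y) - R y)"
    unfolding mixed_term_def B_def[symmetric] \<sigma>_def[symmetric] W_def[symmetric]
    unfolding cube_lebesgue_def by (intro integrable_completion_cong_AE(2))
  also have "\<dots> = (\<Sum>k\<le>\<alpha>. nbern k (x i) * (LINT y|cube_lebesgue B. I k y)) - (LINT y|cube_lebesgue B. R y)"
    using I(1) R(1) int by (simp add: Bochner_Integration.integral_sum)
  also have "(\<Sum>k\<le>\<alpha>. nbern k (x i) * (LINT y|cube_lebesgue B. I k y))
      = (\<Sum>k\<le>\<alpha>. nbern k (x i) * mixed_term x (insert i u) w (\<tau>(i := k)))"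
  proof (rule sum.cong[OF refl])
    fix k assume k: "k \<in> {..\<alpha>}"
    have "mixed_index (insert i u) w (\<tau>(i := k)) = \<sigma>(i := k)"
      by (auto simp: mixed_index_def \<sigma>_def)
    then have "mixed_term x (insert i u) w (\<tau>(i := k)) = (LINT z|cube_lebesgue (insert i B). W z * g k z)"
      by (simp add: mixed_term_def W_def g_def B_def)
    then show "nbern k (x i) * (LINT y|cube_lebesgue B. I k y) = nbern k (x i) * mixed_term x (insert i u) w (\<tau>(i := k))"
      using I(2) k by simp
  qed
  also have "(LINT y|cube_lebesgue B. R y) = mixed_term x u (insert i w) \<tau>"
  proof -
    have "mixed_index u (insert i w) \<tau> = \<sigma>(i := \<alpha>)"
      using i by (auto simp: mixed_index_def \<sigma>_def)
    then show ?thesis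
      unfolding R(2)[symmetric] using i fin by (simp add: mixed_term_def W_def g_def B_def mult.assoc)
  qed
  finally show ?thesis .
qed

lemma mixed_sum_split:
  assumes x: "x \<in> cube" and i: "i \<in> {1..d}" "i \<notin> u" "i \<notin> w" and u: "u \<subseteq> {1..d}" and w: "w \<subseteq> {1..d}"
  shows "mixed_sum x u w = mixed_sum x (insert i u) w - mixed_sum x u (insert i w)"
proof -
  have fin: "finite u"
    using u finite_subset by blast
  have prod: "(\<Prod>j\<in>insert i u. nbern ((\<tau>(i := k)) j) (x j)) = (\<Prod>j\<in>u. nbern (\<tau> j) (x j)) * nbern k (x i)" for \<tau> k
  proof -
    have "(\<Prod>j\<in>u. nbern ((\<tau>(i := k)) j) (x j)) = (\<Prod>j\<in>u. nbern (\<tau> j) (x j))"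
      using i by (intro prod.cong) auto
    then show ?thesis
      using fin i by simp
  qed
  have "mixed_sum x u w = (\<Sum>\<tau>\<in>u \<rightarrow>\<^sub>E {0..\<alpha>}. (\<Prod>j\<in>u. nbern (\<tau> j) (x j)) *
      ((\<Sum>k\<le>\<alpha>. nbern k (x i) * mixed_term x (insert i u) w (\<tau>(i := k))) - mixed_term x u (insert i w) \<tau>))"
    unfolding mixed_sum_def by (intro sum.cong refl) (subst mixed_term_split[OF assms], auto)
  also have "\<dots> = (\<Sum>\<tau>\<in>u \<rightarrow>\<^sub>E {0..\<alpha>}. \<Sum>k\<in>{0..\<alpha>}.
        (\<Prod>j\<in>insert i u. nbern ((\<tau>(i := k)) j) (x j)) * mixed_term x (insert i u) w (\<tau>(i := k)))
      - mixed_sum x u (insert i w)"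
    unfolding prod mixed_sum_def
    by (simp add: right_diff_distrib sum_subtractf sum_distrib_left mult.assoc atMost_atLeast0)
  also have "(\<Sum>\<tau>\<in>u \<rightarrow>\<^sub>E {0..\<alpha>}. \<Sum>k\<in>{0..\<alpha>}.
        (\<Prod>j\<in>insert i u. nbern ((\<tau>(i := k)) j) (x j)) * mixed_term x (insert i u) w (\<tau>(i := k)))
      = mixed_sum x (insert i u) w"
    unfolding mixed_sum_def using fin i by (subst sum_PiE_insert) auto
  finally show ?thesis .
qed

lemma mixed_index_empty: "mixed_index u {} \<tau> = override_on (\<lambda>_. 0) \<tau> u"
  by (auto simp: mixed_index_def override_on_def fun_eq_iff)

lemma mixed_sum_empty: "mixed_sum x {} {} = f x"
  by (simp add: mixed_sum_def mixed_term_def mixed_index_def mixed_deriv_0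
      prob_space.prob_space[OF prob_space_cube_lebesgue])

lemma override_on_full:
  assumes "x \<in> cube" "y \<in> space (cube_lebesgue {1..d})"
  shows "override_on x y {1..d} = y"
  using assms by (auto simp: space_cube_lebesgue override_on_def fun_eq_iff PiE_iff extensional_def)

text \<open>If every coordinate is treated, all integrals are over the whole cube, and \<open>x\<close> enters only through
  the Bernoulli polynomials and the kernels.\<close>
lemma mixed_sum_full:
  assumes x: "x \<in> cube" and u: "u \<subseteq> {1..d}"
  shows "mixed_sum x u ({1..d} - u) = (\<Sum>\<tau>\<in>u \<rightarrow>\<^sub>E {0..\<alpha>}. (\<Prod>j\<in>u. nbern (\<tau> j) (x j)) *
      (LINT y|cube_lebesgue {1..d}. (\<Prod>j\<in>{1..d} - u. pnbern \<alpha> (x j - y j)) *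
         mixed_deriv d (override_on (\<lambda>_. \<alpha>) \<tau> u) f y))"
proof -
  have un: "u \<union> ({1..d} - u) = {1..d}"
    using u by auto
  have eq: "mixed_deriv d (mixed_index u ({1..d} - u) \<tau>) f = mixed_deriv d (override_on (\<lambda>_. \<alpha>) \<tau> u) f" for \<tau>
    by (rule mixed_deriv_cong) (auto simp: mixed_index_def override_on_def)
  show ?thesis
    unfolding mixed_sum_def mixed_term_def un eq
    by (intro sum.cong refl arg_cong2[where f="(*)"] Bochner_Integration.integral_cong)
      (simp only: override_on_full[OF x])
qed

end

section \<open>Recursions over subsets\<close>

lemma inj_on_insert_Pow: "i \<notin> v \<Longrightarrow> inj_on (insert i) (Pow v)"
  by (rule inj_onI) (metis Pow_iff insert_ident subsetD)

text \<open>Two consequences of the recursion for \<open>T\<close>, by induction on the set \<open>v\<close> of coordinates to be split.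
  In each, the subsets of \<open>insert i v\<close> are paired as \<open>u\<close> and \<open>insert i u\<close> with \<open>u \<subseteq> v\<close>.\<close>
lemma alternating_sum_over_subsets:
  fixes T :: "'a set \<Rightarrow> 'a set \<Rightarrow> real"
  assumes step: "\<And>i u w. \<lbrakk>i \<in> S; u \<subseteq> S; w \<subseteq> S; i \<notin> u; i \<notin> w; u \<inter> w = {}\<rbrakk>
      \<Longrightarrow> T u w = T (insert i u) w - T u (insert i w)"
    and v: "finite v" "v \<subseteq> S" and w: "w \<subseteq> S" "v \<inter> w = {}"
  shows "(\<Sum>u\<in>Pow v. (- 1) ^ card u * T u w) = (- 1) ^ card v * T {} (w \<union> v)"
  using v w
proof (induction v arbitrary: w rule: finite_induct)
  case empty
  then show ?case by simp
next
  case (insert i v)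
  have "(\<Sum>u\<in>Pow (insert i v). (- 1) ^ card u * T u w)
      = (\<Sum>u\<in>Pow v. (- 1) ^ card u * T u w) + (\<Sum>u\<in>insert i ` Pow v. (- 1) ^ card u * T u w)"
    unfolding Pow_insert using insert by (intro sum.union_disjoint) auto
  also have "(\<Sum>u\<in>insert i ` Pow v. (- 1) ^ card u * T u w)
      = (\<Sum>u\<in>Pow v. (- 1) ^ card (insert i u) * T (insert i u) w)"
    using insert by (subst sum.reindex) (auto intro: inj_on_insert_Pow)
  also have "(\<Sum>u\<in>Pow v. (- 1) ^ card u * T u w) + \<dots>
      = (\<Sum>u\<in>Pow v. - ((- 1) ^ card u * T u (insert i w)))"
    unfolding sum.distrib[symmetric]
  proof (rule sum.cong[OF refl])
    fix u assume "u \<in> Pow v"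
    then have u: "i \<notin> u" "finite u" "u \<subseteq> S" "u \<inter> w = {}"
      using insert finite_subset[of u v] by auto
    have eq: "T u w = T (insert i u) w - T u (insert i w)"
      using u insert by (intro step) auto
    then show "(- 1) ^ card u * T u w + (- 1) ^ card (insert i u) * T (insert i u) w
        = - ((- 1) ^ card u * T u (insert i w))"
      unfolding eq using u by (simp add: right_diff_distrib)
  qed
  also have "\<dots> = - (\<Sum>u\<in>Pow v. (- 1) ^ card u * T u (insert i w))"
    by (rule sum_negf)
  also have "\<dots> = - ((- 1) ^ card v * T {} (insert i w \<union> v))"
    using insert by (subst insert.IH) auto
  finally show ?case
    using insert by simp
qed

lemma expansion_over_subsets:
  fixes T :: "'a set \<Rightarrow> 'a set \<Rightarrow> real"
  assumes step: "\<And>i u w. \<lbrakk>i \<in> S; u \<subseteq> S; w \<subseteq> S; i \<notin> u; i \<notin> w; u \<inter> w = {}\<rbrakk>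
      \<Longrightarrow> T u w = T (insert i u) w - T u (insert i w)"
    and v: "finite v" "v \<subseteq> S"
  shows "T {} {} = (\<Sum>u\<in>Pow v. (- 1) ^ card (v - u) * T u (v - u))"
  using v
proof (induction v rule: finite_induct)
  case empty
  then show ?case by simp
next
  case (insert i v)
  have "T {} {} = (\<Sum>u\<in>Pow v. (- 1) ^ card (v - u) * T u (v - u))"
    using insert by simp
  also have "\<dots> = (\<Sum>u\<in>Pow v. (- 1) ^ card (insert i v - u) * T u (insert i v - u)
      + (- 1) ^ card (insert i v - insert i u) * T (insert i u) (insert i v - insert i u))"
  proof (rule sum.cong[OF refl])
    fix u assume "u \<in> Pow v"
    then have u: "i \<notin> u" "u \<subseteq> S" "insert i v - u = insert i (v - u)" "insert i v - insert i u = v - u"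
      using insert by auto
    have eq: "T u (v - u) = T (insert i u) (v - u) - T u (insert i (v - u))"
      using u insert by (intro step) auto
    then show "(- 1) ^ card (v - u) * T u (v - u) = (- 1) ^ card (insert i v - u) * T u (insert i v - u)
      + (- 1) ^ card (insert i v - insert i u) * T (insert i u) (insert i v - insert i u)"
      unfolding u(3,4) eq using insert by (simp add: right_diff_distrib)
  qed
  also have "\<dots> = (\<Sum>u\<in>Pow v. (- 1) ^ card (insert i v - u) * T u (insert i v - u))
      + (\<Sum>u\<in>insert i ` Pow v. (- 1) ^ card (insert i v - u) * T u (insert i v - u))"
    unfolding sum.distrib using insert by (subst sum.reindex) (auto intro: inj_on_insert_Pow)
  also have "\<dots> = (\<Sum>u\<in>Pow (insert i v). (- 1) ^ card (insert i v - u) * T u (insert i v - u))"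
    unfolding Pow_insert using insert by (intro sum.union_disjoint[symmetric]) auto
  finally show ?case .
qed

section \<open>The two representations\<close>

theorem proposition2:
  fixes d \<alpha> :: nat and f :: "(nat \<Rightarrow> real) \<Rightarrow> real" and x :: "nat \<Rightarrow> real"
  assumes "d \<ge> 1" and "\<alpha> \<ge> 1"
    and "abs_continuous_mixed_derivs d \<alpha> f"
    and "x \<in> {1..d} \<rightarrow>\<^sub>E {0..1}"
  shows
    "f x =
       (\<Sum>u | u \<noteq> {} \<and> u \<subseteq> {1..d}. (- 1) ^ (card u + 1) *
          (\<Sum>\<tau>\<in>u \<rightarrow>\<^sub>E {0..\<alpha>}.
             (\<Prod>j\<in>u. bernpoly (\<tau> j) (x j) / fact (\<tau> j)) *
             (LINT y|cube_lebesgue u.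
                mixed_deriv d (override_on (\<lambda>_. 0) \<tau> u) f (override_on x y u)))) +
       (- 1) ^ d *
         (LINT y|cube_lebesgue {1..d}.
            (\<Prod>j=1..d. pbernpoly \<alpha> (x j - y j) / fact \<alpha>) * mixed_deriv d (\<lambda>_. \<alpha>) f y)
     \<and>
     f x =
       (\<Sum>u | u \<subseteq> {1..d}. (- 1) ^ (d - card u) *
          (\<Sum>\<tau>\<in>u \<rightarrow>\<^sub>E {0..\<alpha>}.
             (\<Prod>j\<in>u. bernpoly (\<tau> j) (x j) / fact (\<tau> j)) *
             (LINT y|cube_lebesgue {1..d}.
                (\<Prod>j\<in>{1..d} - u. pbernpoly \<alpha> (x j - y j) / fact \<alpha>) *
                mixed_deriv d (override_on (\<lambda>_. \<alpha>) \<tau> u) f y)))"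
proof -
  interpret mixed_smooth d \<alpha> f
    using assms by unfold_locales auto
  note x = assms(4)
  have split: "mixed_sum x u w = mixed_sum x (insert i u) w - mixed_sum x u (insert i w)"
    if "i \<in> {1..d}" "u \<subseteq> {1..d}" "w \<subseteq> {1..d}" "i \<notin> u" "i \<notin> w" for i u w
    using mixed_sum_split[OF x] that by blast
  have Pow: "Pow {1..d} = insert {} {u. u \<noteq> {} \<and> u \<subseteq> {1..d}}"
    by auto
  have fin: "finite {u. u \<noteq> {} \<and> u \<subseteq> {1..d}}"
    by (rule finite_subset[of _ "Pow {1..d}"]) auto
  have S: "mixed_sum x u {} = (\<Sum>\<tau>\<in>u \<rightarrow>\<^sub>E {0..\<alpha>}. (\<Prod>j\<in>u. bernpoly (\<tau> j) (x j) / fact (\<tau> j)) *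
      (LINT y|cube_lebesgue u. mixed_deriv d (override_on (\<lambda>_. 0) \<tau> u) f (override_on x y u)))" for u
    by (simp add: mixed_sum_def mixed_term_def mixed_index_empty nbern_def)
  have R: "mixed_sum x {} {1..d} = (LINT y|cube_lebesgue {1..d}.
      (\<Prod>j=1..d. pbernpoly \<alpha> (x j - y j) / fact \<alpha>) * mixed_deriv d (\<lambda>_. \<alpha>) f y)"
    using mixed_sum_full[OF x, of "{}"] by (simp add: pnbern_def)
  have "(\<Sum>u\<in>Pow {1..d}. (- 1) ^ card u * mixed_sum x u {}) = (- 1) ^ card {1..d} * mixed_sum x {} ({} \<union> {1..d})"
    by (rule alternating_sum_over_subsets[where S = "{1..d}"]) (use split in auto)
  then have "f x = - (\<Sum>u | u \<noteq> {} \<and> u \<subseteq> {1..d}. (- 1) ^ card u * mixed_sum x u {}) + (- 1) ^ d * mixed_sum x {} {1..d}"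
    unfolding Pow using fin by (simp add: mixed_sum_empty)
  then have i: "f x = (\<Sum>u | u \<noteq> {} \<and> u \<subseteq> {1..d}. (- 1) ^ (card u + 1) * mixed_sum x u {})
      + (- 1) ^ d * mixed_sum x {} {1..d}"
    by (simp add: sum_negf)
  have "mixed_sum x {} {} = (\<Sum>u\<in>Pow {1..d}. (- 1) ^ card ({1..d} - u) * mixed_sum x u ({1..d} - u))"
    by (rule expansion_over_subsets[where S = "{1..d}"]) (use split in auto)
  then have "f x = (\<Sum>u\<in>Pow {1..d}. (- 1) ^ card ({1..d} - u) * mixed_sum x u ({1..d} - u))"
    by (simp only: mixed_sum_empty)
  also have "\<dots> = (\<Sum>u | u \<subseteq> {1..d}. (- 1) ^ (d - card u) *
      (\<Sum>\<tau>\<in>u \<rightarrow>\<^sub>E {0..\<alpha>}. (\<Prod>j\<in>u. bernpoly (\<tau> j) (x j) / fact (\<tau> j)) *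
        (LINT y|cube_lebesgue {1..d}. (\<Prod>j\<in>{1..d} - u. pbernpoly \<alpha> (x j - y j) / fact \<alpha>) *
           mixed_deriv d (override_on (\<lambda>_. \<alpha>) \<tau> u) f y)))"
  proof (rule sum.cong)
    fix u assume "u \<in> {u. u \<subseteq> {1..d}}"
    then have u: "u \<subseteq> {1..d}" by simp
    then have "card ({1..d} - u) = d - card u"
      using card_Diff_subset[OF finite_subset[OF u] u] by simp
    then show "(- 1) ^ card ({1..d} - u) * mixed_sum x u ({1..d} - u) = (- 1) ^ (d - card u) *
      (\<Sum>\<tau>\<in>u \<rightarrow>\<^sub>E {0..\<alpha>}. (\<Prod>j\<in>u. bernpoly (\<tau> j) (x j) / fact (\<tau> j)) *
        (LINT y|cube_lebesgue {1..d}. (\<Prod>j\<in>{1..d} - u. pbernpoly \<alpha> (x j - y j) / fact \<alpha>) *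
           mixed_deriv d (override_on (\<lambda>_. \<alpha>) \<tau> u) f y))"
      using mixed_sum_full[OF x u] by (simp add: nbern_def pnbern_def)
  qed auto
  finally show ?thesis
    using i unfolding S R by blast
qed

end
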